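(* Let $f\colon X_1\to X_2$ be a quasi-isometry between hyperbolic geodesic semimetric spaces $X_1$ and $X_2$ that satisfy (B1) and (B2). Then $f$ canonically defines three order-preserving bijective maps: one $\partial^fX_1\to\partial^fX_2$ between the quasi-geodesic f-boundaries, one $\partial^bX_1\to\partial^bX_2$ between the quasi-geodesic b-boundaries, and one $\partial X_1\to\partial X_2$ between the quasi-geodesic boundaries.
   Context: A semimetric on a set $X$ is a map $d\colon X\times X\to[0,\infty]$ with $d(x,y)=0$ if and only if $x=y$, and $d(x,y)\le d(x,z)+d(z,y)$ (no symmetry). Put $\mathcal B^+_r(x)=\{y: d(x,y)\le r\}$, $\mathcal B^-_r(x)=\{y: d(y,x)\le r\}$, and $\mathcal B^{\pm}_r(Y)=\bigcup_{y\in Y}\mathcal B^{\pm}_r(y)$ for $Y\subseteq X$ (or $Y$ a path or ray, meaning its image). The forward topology is generated by the open out-balls $\{y: d(x,y)<r\}$, the backward topology by the open in-balls $\{y: d(y,x)<r\}$. A directed path from $x$ to $y$ is a map $P\colon[a,b]\to X$ ($a<b$ real) with $P(a)=x$ (starting point), $P(b)=y$ (end point) that is continuous with respect to the forward topologies and with respect to the backward topologies, where real intervals carry the semimetric $d(s,t)=t-s$ if $s\le t$ and $\infty$ otherwise. Its length is $\ell(P)=\lim_{N\to\infty}\sum_{i=1}^N d(P(t_{i-1}),P(t_i))$ with $t_i=a+i(b-a)/N$. It is a geodesic if $\ell(P)=d(x,y)$, and a $(\gamma,c)$-quasi-geodesic ($\gamma\ge1,c\ge0$) if $\ell(uPv)\le\gamma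 d(u,v)+c$ for all directed subpaths $uPv$ of $P$ from $u$ to $v$. $X$ is geodesic if there is a geodesic from $x$ to $y$ whenever $d(x,y)<\infty$. A geodesic triangle consists of three points and three geodesics (its sides), one between every two of these points (in one of the two directions). It is $\delta$-thin if for every labelling $P,Q,R$ of its sides such that the starting point of $P$ is the starting or the end point of $Q$ and the end point of $P$ is the starting or the end point of $R$, we have $P\subseteq\mathcal B^+_\delta(Q)\cup\mathcal B^-_\delta(R)$. $X$ is hyperbolic if for some $\delta\ge0$ all geodesic triangles are $\delta$-thin. (B1): there is $h\colon\mathbb R\to\mathbb R$ such that for all $x\in X$, $r\ge0$ and $y,z\in\mathcal B^+_r(x)$, $d(y,z)$ is either $\infty$ or at most $h(r)$. (B2): the same with $\mathcal B^-_r(x)$ in place of $\mathcal B^+_r(x)$. A ray is a map $R\colon[0,\infty)\to X$, continuous with respect to the forward and backward topologies, such that for all $x\in X$, $r\ge0$ there is $p\ge0$ with $R([p,\infty))\cap\mathcal B^+_r(x)=\emptyset$. An anti-ray is a map $R\colon(-\infty,0]\to X$, continuous in the same sense, such that for all $x\in X$, $r\ge0$ there is $p\le0$ with $R((-\infty,p])\cap\mathcal B^-_r(x)=\emptyset$. A (anti-)ray is quasi-geodesic if for some $\gamma,c$ all its finite directed subpaths are $(\gamma,c)$-quasi-geodesics. For quasi-geodesic rays or anti-rays $R_1,R_2$ write $R_1\le R_2$ if there is $M\ge0$ such that for every $r\ge0$ and $x\in X$ there is a directed path from a point of $R_1$ to a point of $R_2$ of length at most $M$ outside of $\mathcal B^+_r(x)\cup\mathcal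 B^-_r(x)$; $R_1\approx R_2$ means $R_1\le R_2\le R_1$. In a hyperbolic geodesic semimetric space with (B1) and (B2), $\le$ is a quasiorder, so $\approx$ is an equivalence relation. $\partial X$ is the set of $\approx$-classes of quasi-geodesic rays and anti-rays; $\partial^fX$ (resp. $\partial^bX$) is the set of classes of $\approx$ restricted to quasi-geodesic rays (resp. anti-rays). All three are ordered by the order induced by $\le$. A map $f\colon X\to Y$ is a quasi-isometry if for some $\gamma\ge1,c\ge0$: $\gamma^{-1}d_X(x,x')-c\le d_Y(f(x),f(x'))\le\gamma d_X(x,x')+c$ for all $x,x'\in X$, and for every $y\in Y$ there is $x\in X$ with $d_Y(f(x),y)\le c$ and $d_Y(y,f(x))\le c$. "Canonically defines" means: the class of a quasi-geodesic ray (anti-ray) $R$ in $X_1$ is mapped to the class of the quasi-geodesic rays (anti-rays) $Q$ in $X_2$ that follow $f(R)$, i.e. for which there is $K\ge0$ such that $f(R)\subseteq\mathcal B^+_K(Q)\cap\mathcal B^-_K(Q)$ and $Q\subseteq\mathcal B^+_K(f(R))\cap\mathcal B^-_K(f(R))$. *)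

theory Defs
  imports "HOL-Analysis.Analysis" "HOL-Library.Multiset"
begin

text \<open>
  A semimetric space is a carrier set \<open>X\<close> together with a distance \<open>d\<close>, of which only the
  values on \<open>X\<close> matter.
\<close>

definition semimetric_on :: "'a set \<Rightarrow> ('a \<Rightarrow> 'a \<Rightarrow> ennreal) \<Rightarrow> bool" where
  "semimetric_on X d \<longleftrightarrow>
     (\<forall>x\<in>X. \<forall>y\<in>X. d x y = 0 \<longleftrightarrow> x = y) \<and>
     (\<forall>x\<in>X. \<forall>y\<in>X. \<forall>z\<in>X. d x y \<le> d x z + d z y)"

definition out_ball :: "'a set \<Rightarrow> ('a \<Rightarrow> 'a \<Rightarrow> ennreal) \<Rightarrow> real \<Rightarrow> 'a \<Rightarrow> 'a set" where
  "out_ball X d r x = {y \<in> X. d x y \<le> ennreal r}"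

definition in_ball :: "'a set \<Rightarrow> ('a \<Rightarrow> 'a \<Rightarrow> ennreal) \<Rightarrow> real \<Rightarrow> 'a \<Rightarrow> 'a set" where
  "in_ball X d r x = {y \<in> X. d y x \<le> ennreal r}"

definition out_nbhd :: "'a set \<Rightarrow> ('a \<Rightarrow> 'a \<Rightarrow> ennreal) \<Rightarrow> real \<Rightarrow> 'a set \<Rightarrow> 'a set" where
  "out_nbhd X d r Y = (\<Union>y\<in>Y. out_ball X d r y)"

definition in_nbhd :: "'a set \<Rightarrow> ('a \<Rightarrow> 'a \<Rightarrow> ennreal) \<Rightarrow> real \<Rightarrow> 'a set \<Rightarrow> 'a set" where
  "in_nbhd X d r Y = (\<Union>y\<in>Y. in_ball X d r y)"

definition forward_topology :: "'a set \<Rightarrow> ('a \<Rightarrow> 'a \<Rightarrow> ennreal) \<Rightarrow> 'a topology" where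
  "forward_topology X d =
     topology_generated_by {{y \<in> X. d x y < ennreal r} | x r. x \<in> X \<and> 0 < r}"

definition backward_topology :: "'a set \<Rightarrow> ('a \<Rightarrow> 'a \<Rightarrow> ennreal) \<Rightarrow> 'a topology" where
  "backward_topology X d =
     topology_generated_by {{y \<in> X. d y x < ennreal r} | x r. x \<in> X \<and> 0 < r}"

definition line_dist :: "real \<Rightarrow> real \<Rightarrow> ennreal" where
  "line_dist s t = (if s \<le> t then ennreal (t - s) else \<infinity>)"

definition bicontinuous ::
    "real set \<Rightarrow> 'a set \<Rightarrow> ('a \<Rightarrow> 'a \<Rightarrow> ennreal) \<Rightarrow> (real \<Rightarrow> 'a) \<Rightarrow> bool" where
  "bicontinuous I X d P \<longleftrightarrow>
     continuous_map (forward_topology I line_dist) (forward_topology X d) P \<and>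
     continuous_map (backward_topology I line_dist) (backward_topology X d) P"

text \<open>
  The triple \<open>(a, b, P)\<close> stands for the map \<open>P\<close> restricted to \<open>[a, b]\<close>.
\<close>

type_synonym 'a dpath = "real \<times> real \<times> (real \<Rightarrow> 'a)"

fun directed_path :: "'a set \<Rightarrow> ('a \<Rightarrow> 'a \<Rightarrow> ennreal) \<Rightarrow> 'a dpath \<Rightarrow> bool" where
  "directed_path X d (a, b, P) \<longleftrightarrow> a < b \<and> bicontinuous {a..b} X d P"

fun start_point :: "'a dpath \<Rightarrow> 'a" where
  "start_point (a, b, P) = P a"

fun end_point :: "'a dpath \<Rightarrow> 'a" where
  "end_point (a, b, P) = P b"

fun path_points :: "'a dpath \<Rightarrow> 'a set" where
  "path_points (a, b, P) = P ` {a..b}"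

text \<open>
  For a directed path in a semimetric space the limit always exists in \<open>[0, \<infinity>]\<close>: by the triangle
  inequality and the two continuity conditions it is the supremum over all partitions.
\<close>

fun path_length :: "('a \<Rightarrow> 'a \<Rightarrow> ennreal) \<Rightarrow> 'a dpath \<Rightarrow> ennreal" where
  "path_length d (a, b, P) =
     lim (\<lambda>N. \<Sum>i=1..N. d (P (a + real (i - 1) * (b - a) / real N))
                            (P (a + real i * (b - a) / real N)))"

definition is_geodesic :: "'a set \<Rightarrow> ('a \<Rightarrow> 'a \<Rightarrow> ennreal) \<Rightarrow> 'a dpath \<Rightarrow> bool" where
  "is_geodesic X d p \<longleftrightarrow>
     directed_path X d p \<and> path_length d p = d (start_point p) (end_point p)"

fun quasi_geodesic ::
    "'a set \<Rightarrow> ('a \<Rightarrow> 'a \<Rightarrow> ennreal) \<Rightarrow> real \<Rightarrow> real \<Rightarrow> 'a dpath \<Rightarrow> bool" where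
  "quasi_geodesic X d \<gamma> c (a, b, P) \<longleftrightarrow>
     directed_path X d (a, b, P) \<and>
     (\<forall>s t. a \<le> s \<and> s < t \<and> t \<le> b \<longrightarrow>
        path_length d (s, t, P) \<le> ennreal \<gamma> * d (P s) (P t) + ennreal c)"

definition geodesic_space :: "'a set \<Rightarrow> ('a \<Rightarrow> 'a \<Rightarrow> ennreal) \<Rightarrow> bool" where
  "geodesic_space X d \<longleftrightarrow>
     (\<forall>x\<in>X. \<forall>y\<in>X. d x y < \<infinity> \<longrightarrow>
        (\<exists>p. is_geodesic X d p \<and> start_point p = x \<and> end_point p = y))"

definition joins :: "'a dpath \<Rightarrow> 'a \<Rightarrow> 'a \<Rightarrow> bool" where
  "joins p x y \<longleftrightarrow>
     (start_point p = x \<and> end_point p = y) \<or> (start_point p = y \<and> end_point p = x)"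

definition geodesic_triangle ::
    "'a set \<Rightarrow> ('a \<Rightarrow> 'a \<Rightarrow> ennreal) \<Rightarrow> 'a dpath \<Rightarrow> 'a dpath \<Rightarrow> 'a dpath \<Rightarrow> bool" where
  "geodesic_triangle X d S1 S2 S3 \<longleftrightarrow>
     is_geodesic X d S1 \<and> is_geodesic X d S2 \<and> is_geodesic X d S3 \<and>
     (\<exists>x\<in>X. \<exists>y\<in>X. \<exists>z\<in>X. joins S1 x y \<and> joins S2 y z \<and> joins S3 z x)"

text \<open>
  The multiset equation says that \<open>P, Q, R\<close> is a labelling of the three sides.
\<close>

definition thin_triangle ::
    "'a set \<Rightarrow> ('a \<Rightarrow> 'a \<Rightarrow> ennreal) \<Rightarrow> real \<Rightarrow> 'a dpath \<Rightarrow> 'a dpath \<Rightarrow> 'a dpath \<Rightarrow> bool" where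
  "thin_triangle X d \<delta> S1 S2 S3 \<longleftrightarrow>
     (\<forall>P Q R. {#P, Q, R#} = {#S1, S2, S3#} \<and>
        start_point P \<in> {start_point Q, end_point Q} \<and>
        end_point P \<in> {start_point R, end_point R} \<longrightarrow>
        path_points P \<subseteq> out_nbhd X d \<delta> (path_points Q) \<union> in_nbhd X d \<delta> (path_points R))"

definition hyperbolic_space :: "'a set \<Rightarrow> ('a \<Rightarrow> 'a \<Rightarrow> ennreal) \<Rightarrow> bool" where
  "hyperbolic_space X d \<longleftrightarrow>
     (\<exists>\<delta>\<ge>0. \<forall>S1 S2 S3. geodesic_triangle X d S1 S2 S3 \<longrightarrow> thin_triangle X d \<delta> S1 S2 S3)"

definition cond_B1 :: "'a set \<Rightarrow> ('a \<Rightarrow> 'a \<Rightarrow> ennreal) \<Rightarrow> bool" where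
  "cond_B1 X d \<longleftrightarrow>
     (\<exists>h :: real \<Rightarrow> real. \<forall>x\<in>X. \<forall>r\<ge>0. \<forall>y\<in>out_ball X d r x. \<forall>z\<in>out_ball X d r x.
        d y z = \<infinity> \<or> d y z \<le> ennreal (h r))"

definition cond_B2 :: "'a set \<Rightarrow> ('a \<Rightarrow> 'a \<Rightarrow> ennreal) \<Rightarrow> bool" where
  "cond_B2 X d \<longleftrightarrow>
     (\<exists>h :: real \<Rightarrow> real. \<forall>x\<in>X. \<forall>r\<ge>0. \<forall>y\<in>in_ball X d r x. \<forall>z\<in>in_ball X d r x.
        d y z = \<infinity> \<or> d y z \<le> ennreal (h r))"

text \<open>
  The constructor records the domain, \<open>[0, \<infinity>)\<close> for a ray and \<open>(-\<infinity>, 0]\<close> for an anti-ray, so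
  that the two kinds stay apart. Values of the map outside of its domain are irrelevant to all notions
  below; in particular two representations of the same (anti-)ray lie in the same boundary point.
\<close>

datatype 'a end_ray = Ray "real \<Rightarrow> 'a" | Anti_Ray "real \<Rightarrow> 'a"

fun ray_points :: "'a end_ray \<Rightarrow> 'a set" where
  "ray_points (Ray R) = R ` {0..}"
| "ray_points (Anti_Ray R) = R ` {..0}"

fun same_kind :: "'a end_ray \<Rightarrow> 'b end_ray \<Rightarrow> bool" where
  "same_kind (Ray R) (Ray Q) \<longleftrightarrow> True"
| "same_kind (Anti_Ray R) (Anti_Ray Q) \<longleftrightarrow> True"
| "same_kind (Ray R) (Anti_Ray Q) \<longleftrightarrow> False"
| "same_kind (Anti_Ray R) (Ray Q) \<longleftrightarrow> False"

definition is_ray :: "'a set \<Rightarrow> ('a \<Rightarrow> 'a \<Rightarrow> ennreal) \<Rightarrow> (real \<Rightarrow> 'a) \<Rightarrow> bool" where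
  "is_ray X d R \<longleftrightarrow>
     bicontinuous {0..} X d R \<and>
     (\<forall>x\<in>X. \<forall>r\<ge>0. \<exists>p\<ge>0. R ` {p..} \<inter> out_ball X d r x = {})"

definition is_anti_ray :: "'a set \<Rightarrow> ('a \<Rightarrow> 'a \<Rightarrow> ennreal) \<Rightarrow> (real \<Rightarrow> 'a) \<Rightarrow> bool" where
  "is_anti_ray X d R \<longleftrightarrow>
     bicontinuous {..0} X d R \<and>
     (\<forall>x\<in>X. \<forall>r\<ge>0. \<exists>p\<le>0. R ` {..p} \<inter> in_ball X d r x = {})"

definition qg_rays :: "'a set \<Rightarrow> ('a \<Rightarrow> 'a \<Rightarrow> ennreal) \<Rightarrow> 'a end_ray set" where
  "qg_rays X d = {Ray R | R. is_ray X d R \<and>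
     (\<exists>\<gamma>\<ge>1. \<exists>c\<ge>0. \<forall>a b. 0 \<le> a \<and> a < b \<longrightarrow> quasi_geodesic X d \<gamma> c (a, b, R))}"

definition qg_anti_rays :: "'a set \<Rightarrow> ('a \<Rightarrow> 'a \<Rightarrow> ennreal) \<Rightarrow> 'a end_ray set" where
  "qg_anti_rays X d = {Anti_Ray R | R. is_anti_ray X d R \<and>
     (\<exists>\<gamma>\<ge>1. \<exists>c\<ge>0. \<forall>a b. a < b \<and> b \<le> 0 \<longrightarrow> quasi_geodesic X d \<gamma> c (a, b, R))}"

definition ray_le ::
    "'a set \<Rightarrow> ('a \<Rightarrow> 'a \<Rightarrow> ennreal) \<Rightarrow> 'a end_ray \<Rightarrow> 'a end_ray \<Rightarrow> bool" where
  "ray_le X d R1 R2 \<longleftrightarrow>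
     (\<exists>M\<ge>0. \<forall>r\<ge>0. \<forall>x\<in>X. \<exists>p. directed_path X d p \<and>
        start_point p \<in> ray_points R1 \<and> end_point p \<in> ray_points R2 \<and>
        path_length d p \<le> ennreal M \<and>
        path_points p \<inter> (out_ball X d r x \<union> in_ball X d r x) = {})"

text \<open>
  The relation \<open>\<approx>\<close> restricted to a set \<open>E\<close> of (anti-)rays.
\<close>

definition ray_equiv ::
    "'a set \<Rightarrow> ('a \<Rightarrow> 'a \<Rightarrow> ennreal) \<Rightarrow> 'a end_ray set \<Rightarrow> ('a end_ray \<times> 'a end_ray) set" where
  "ray_equiv X d E = {(R, S). R \<in> E \<and> S \<in> E \<and> ray_le X d R S \<and> ray_le X d S R}"

definition classes ::
    "'a set \<Rightarrow> ('a \<Rightarrow> 'a \<Rightarrow> ennreal) \<Rightarrow> 'a end_ray set \<Rightarrow> 'a end_ray set set" where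
  "classes X d E = E // ray_equiv X d E"

definition f_boundary :: "'a set \<Rightarrow> ('a \<Rightarrow> 'a \<Rightarrow> ennreal) \<Rightarrow> 'a end_ray set set" where
  "f_boundary X d = classes X d (qg_rays X d)"

definition b_boundary :: "'a set \<Rightarrow> ('a \<Rightarrow> 'a \<Rightarrow> ennreal) \<Rightarrow> 'a end_ray set set" where
  "b_boundary X d = classes X d (qg_anti_rays X d)"

definition qg_boundary :: "'a set \<Rightarrow> ('a \<Rightarrow> 'a \<Rightarrow> ennreal) \<Rightarrow> 'a end_ray set set" where
  "qg_boundary X d = classes X d (qg_rays X d \<union> qg_anti_rays X d)"

definition class_le ::
    "'a set \<Rightarrow> ('a \<Rightarrow> 'a \<Rightarrow> ennreal) \<Rightarrow> 'a end_ray set \<Rightarrow> 'a end_ray set \<Rightarrow> bool" where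
  "class_le X d A B \<longleftrightarrow> (\<exists>R\<in>A. \<exists>S\<in>B. ray_le X d R S)"

definition quasi_isometry ::
    "'a set \<Rightarrow> ('a \<Rightarrow> 'a \<Rightarrow> ennreal) \<Rightarrow> 'b set \<Rightarrow> ('b \<Rightarrow> 'b \<Rightarrow> ennreal) \<Rightarrow> ('a \<Rightarrow> 'b) \<Rightarrow> bool" where
  "quasi_isometry X dX Y dY f \<longleftrightarrow>
     f \<in> X \<rightarrow> Y \<and>
     (\<exists>\<gamma>\<ge>1. \<exists>c\<ge>0.
        (\<forall>x\<in>X. \<forall>x'\<in>X.
           ennreal (1 / \<gamma>) * dX x x' - ennreal c \<le> dY (f x) (f x') \<and>
           dY (f x) (f x') \<le> ennreal \<gamma> * dX x x' + ennreal c) \<and>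
        (\<forall>y\<in>Y. \<exists>x\<in>X. dY (f x) y \<le> ennreal c \<and> dY y (f x) \<le> ennreal c))"

text \<open>
  \<open>Q\<close> stays close to the point set \<open>Z\<close> and vice versa; used with \<open>Z = f(R)\<close>.
\<close>

definition follows ::
    "'a set \<Rightarrow> ('a \<Rightarrow> 'a \<Rightarrow> ennreal) \<Rightarrow> 'a end_ray \<Rightarrow> 'a set \<Rightarrow> bool" where
  "follows X d Q Z \<longleftrightarrow>
     (\<exists>K\<ge>0. Z \<subseteq> out_nbhd X d K (ray_points Q) \<inter> in_nbhd X d K (ray_points Q) \<and>
            ray_points Q \<subseteq> out_nbhd X d K Z \<inter> in_nbhd X d K Z)"

text \<open>
  \<open>\<phi>\<close> is the map on classes defined canonically by \<open>f\<close>, where \<open>E1\<close> and \<open>E2\<close> are the sets of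
  (anti-)rays considered in the two spaces. The existence part makes sure that the prescription
  actually determines the image of every class.
\<close>

definition canonically_defines ::
    "'a set \<Rightarrow> ('a \<Rightarrow> 'a \<Rightarrow> ennreal) \<Rightarrow> 'a end_ray set \<Rightarrow>
     'b set \<Rightarrow> ('b \<Rightarrow> 'b \<Rightarrow> ennreal) \<Rightarrow> 'b end_ray set \<Rightarrow>
     ('a \<Rightarrow> 'b) \<Rightarrow> ('a end_ray set \<Rightarrow> 'b end_ray set) \<Rightarrow> bool" where
  "canonically_defines X1 d1 E1 X2 d2 E2 f \<phi> \<longleftrightarrow>
     (\<forall>R\<in>E1.
        (\<exists>Q\<in>E2. same_kind R Q \<and> follows X2 d2 Q (f ` ray_points R)) \<and>
        (\<forall>Q\<in>E2. same_kind R Q \<and> follows X2 d2 Q (f ` ray_points R) \<longrightarrow>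
           \<phi> (ray_equiv X1 d1 E1 `` {R}) = ray_equiv X2 d2 E2 `` {Q}))"

end

theory Submission
  imports Defs
begin

text \<open>
  Two observations carry the proof.

  Firstly, the image of a quasi-geodesic ray \<open>R\<close> can be followed. Sample \<open>R\<close> at points of
  consecutive distance \<open>1\<close>, so that distances along the sampling grow linearly, and join the images
  of consecutive points by geodesics. Since the quasi-isometry distorts distances linearly, the
  concatenation is a quasi-geodesic ray that stays near the image of \<open>R\<close>, and vice versa
  (\<open>ray_follower\<close>). For anti-rays one reverses all distances and paths. A quasi-isometry has
  a quasi-inverse \<open>g\<close>, and \<open>Q\<close> follows \<open>f (R)\<close> if and only if \<open>R\<close> follows \<open>g (Q)\<close>
  (\<open>follows_inverse\<close>); hence conversely each \<open>Q\<close> follows the image of some \<open>R\<close>.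

  Secondly, followers have the same order relations as the original rays. By (B1) and (B2), rays and
  anti-rays leave not only the balls of the kind in their definition but all out-balls and all in-balls
  (\<open>tame_tail\<close>), while initial segments are bounded. So \<open>R \<le> S\<close> means that for some \<open>M\<close> there are
  points arbitrarily far out on \<open>R\<close> and on \<open>S\<close> with distance at most \<open>M\<close> from the first to the second
  (\<open>ray_le_iff_tail_le\<close>). This passes to the followers because \<open>f\<close> changes distances in a
  controlled way and takes far out points close to far out points (\<open>ray_le_transfer\<close>), and it passes
  back through the quasi-inverse.

  Thus following is a correspondence, total in both directions, between the (anti-)rays of the two
  spaces that preserves and reflects the order. Such a correspondence induces an order-preserving
  bijection between the classes (\<open>class_bijection\<close>), and this is applied to rays, to anti-rays and to
  both together.

  Two facts about lengths are needed to work with the definition as a limit: the length of a directed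
  path is at least every sum over a partition (\<open>chain_sum_le_path_length\<close>), and at most the total
  increase of any function whose increments dominate the distances (\<open>path_length_le\<close>).
\<close>

section \<open>Semimetrics\<close>

lemma semimetric_zero_iff:
  "semimetric_on X d \<Longrightarrow> x \<in> X \<Longrightarrow> y \<in> X \<Longrightarrow> d x y = 0 \<longleftrightarrow> x = y"
  unfolding semimetric_on_def by blast

lemma semimetric_zero: "semimetric_on X d \<Longrightarrow> x \<in> X \<Longrightarrow> d x x = 0"
  by (simp add: semimetric_zero_iff)

lemma semimetric_triangle:
  assumes "semimetric_on X d" "x \<in> X" "y \<in> X" "z \<in> X"
  shows "d x y \<le> d x z + d z y"
  using assms unfolding semimetric_on_def by blast

lemma triangle_bound:
  assumes "semimetric_on X d" "x \<in> X" "y \<in> X" "z \<in> X"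
    and "d x z \<le> ennreal a" "d z y \<le> ennreal b" "0 \<le> a" "0 \<le> b"
  shows "d x y \<le> ennreal (a + b)"
proof -
  have "d x y \<le> d x z + d z y" using assms by (intro semimetric_triangle)
  also have "\<dots> \<le> ennreal a + ennreal b" using assms by (intro add_mono)
  finally show ?thesis using assms by simp
qed

lemma finite_ennreal_cases:
  assumes "(e::ennreal) < \<infinity>"
  obtains k where "0 \<le> k" "e = ennreal k"
  using assms by (cases e) auto

text \<open>
  Swapping the arguments exchanges forward and backward notions and turns an anti-ray \<open>R\<close> into the
  ray \<open>s \<mapsto> R (-s)\<close>, so that statements about anti-rays follow from those about rays. The
  abbreviation is for input only because its right-hand side matches every distance function, its
  own instances included.
\<close>

abbreviation (input) dual_dist :: "('a \<Rightarrow> 'a \<Rightarrow> ennreal) \<Rightarrow> 'a \<Rightarrow> 'a \<Rightarrow> ennreal" where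
  "dual_dist d \<equiv> \<lambda>x y. d y x"

lemma semimetric_on_dual:
  assumes "semimetric_on X d"
  shows "semimetric_on X (dual_dist d)"
  unfolding semimetric_on_def
proof (intro conjI ballI)
  fix x y z assume "x \<in> X" "y \<in> X" "z \<in> X"
  then have "d y x \<le> d y z + d z x"
    by (intro semimetric_triangle[OF assms])
  then show "d y x \<le> d z x + d y z"
    by (metis add.commute)
next
  fix x y assume "x \<in> X" "y \<in> X"
  then show "(d y x = 0) = (x = y)"
    using semimetric_zero_iff[OF assms, of y x] by auto
qed

lemma semimetric_line_dist: "semimetric_on I line_dist"
proof -
  have "line_dist x y \<le> line_dist x z + line_dist z y" for x y z
    by (cases "x \<le> z"; cases "z \<le> y") (simp_all add: line_dist_def flip: ennreal_plus)
  then show ?thesis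
    unfolding semimetric_on_def by (auto simp: line_dist_def)
qed

lemma backward_topology_eq: "backward_topology X d = forward_topology X (dual_dist d)"
  by (simp add: backward_topology_def forward_topology_def)

section \<open>Bicontinuity by epsilon and delta\<close>

text \<open>
  The open out-balls are only a subbase by definition. By the triangle inequality an open out-ball
  contains a small out-ball around each of its points, and \<open>d x x = 0\<close> puts \<open>x\<close> into every ball
  around \<open>x\<close>, so the balls form a base.
\<close>

lemma openin_forward_iff:
  assumes "semimetric_on X d"
  shows "openin (forward_topology X d) U \<longleftrightarrow>
    U \<subseteq> X \<and> (\<forall>x\<in>U. \<exists>e>0. \<forall>y\<in>X. d x y < ennreal e \<longrightarrow> y \<in> U)" (is "_ \<longleftrightarrow> ?R U")
proof
  let ?S = "{{y \<in> X. d x y < ennreal r} | x r. x \<in> X \<and> 0 < r}"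
  assume "openin (forward_topology X d) U"
  then have "generate_topology_on ?S U"
    by (simp add: forward_topology_def openin_topology_generated_by_iff)
  then show "?R U"
  proof induction
    case (Int A B)
    then show ?case
    proof (intro conjI ballI)
      fix x assume x: "x \<in> A \<inter> B"
      obtain e1 where e1: "e1 > 0" "\<forall>y\<in>X. d x y < ennreal e1 \<longrightarrow> y \<in> A"
        using x Int by blast
      obtain e2 where e2: "e2 > 0" "\<forall>y\<in>X. d x y < ennreal e2 \<longrightarrow> y \<in> B"
        using x Int by blast
      show "\<exists>e>0. \<forall>y\<in>X. d x y < ennreal e \<longrightarrow> y \<in> A \<inter> B"
      proof (intro exI[of _ "min e1 e2"] conjI ballI impI)
        fix y assume "y \<in> X" "d x y < ennreal (min e1 e2)"
        moreover have "ennreal (min e1 e2) \<le> ennreal e1" "ennreal (min e1 e2) \<le> ennreal e2"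
          by (simp_all add: ennreal_leI)
        ultimately show "y \<in> A \<inter> B" using e1 e2 by (meson IntI order_less_le_trans)
      qed (use e1 e2 in auto)
    qed auto
  next
    case (UN K)
    show ?case
    proof (intro conjI ballI)
      show "\<Union>K \<subseteq> X" using UN by auto
      fix x assume "x \<in> \<Union>K"
      then obtain A where "A \<in> K" "x \<in> A" by auto
      with UN.IH[of A] show "\<exists>e>0. \<forall>y\<in>X. d x y < ennreal e \<longrightarrow> y \<in> \<Union>K"
        by (meson UnionI)
    qed
  next
    case (Basis s)
    then obtain x r where s: "s = {y \<in> X. d x y < ennreal r}" "x \<in> X" "0 < r" by auto
    show ?case
    proof (intro conjI ballI)
      show "s \<subseteq> X" using s by auto
      fix z assume "z \<in> s"
      then have z: "z \<in> X" "d x z < ennreal r" using s by auto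
      obtain k where k: "0 \<le> k" "d x z = ennreal k"
        using z(2) by (cases "d x z") auto
      have kr: "k < r" using z k by (simp add: ennreal_less_iff)
      show "\<exists>e>0. \<forall>y\<in>X. d z y < ennreal e \<longrightarrow> y \<in> s"
      proof (intro exI[of _ "r - k"] conjI ballI impI)
        fix y assume y: "y \<in> X" "d z y < ennreal (r - k)"
        have "d x y \<le> d x z + d z y"
          using assms s y z by (intro semimetric_triangle) auto
        also have "\<dots> < ennreal k + ennreal (r - k)"
          using y k by (simp add: ennreal_add_left_cancel_less)
        also have "\<dots> = ennreal r" using k kr by (simp flip: ennreal_plus)
        finally show "y \<in> s" using s y by auto
      qed (use kr in auto)
    qed
  qed auto
next
  assume R: "?R U"
  then obtain e where e: "\<And>x. x \<in> U \<Longrightarrow> e x > 0 \<and> (\<forall>y\<in>X. d x y < ennreal (e x) \<longrightarrow> y \<in> U)"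
    by metis
  define B where "B = (\<Union>x\<in>U. {y \<in> X. d x y < ennreal (e x)})"
  have "U = B"
    unfolding B_def
  proof (intro equalityI subsetI)
    fix x assume "x \<in> U"
    moreover from this have "d x x = 0" "x \<in> X" "e x > 0" using R e semimetric_zero[OF assms] by auto
    ultimately show "x \<in> (\<Union>x\<in>U. {y \<in> X. d x y < ennreal (e x)})" by force
  qed (use e in auto)
  moreover have "openin (forward_topology X d) B"
    unfolding B_def
  proof (rule openin_Union, elim imageE, hypsubst)
    fix x assume "x \<in> U"
    then show "openin (forward_topology X d) {y \<in> X. d x y < ennreal (e x)}"
    unfolding forward_topology_def
    by (intro topology_generated_by_Basis) (use e R in blast)
  qed
  ultimately show "openin (forward_topology X d) U" by simp
qed

lemma topspace_forward:
  assumes "semimetric_on X d"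
  shows "topspace (forward_topology X d) = X"
proof (rule antisym)
  show "topspace (forward_topology X d) \<subseteq> X"
    using openin_forward_iff[OF assms] by (metis openin_topspace)
  show "X \<subseteq> topspace (forward_topology X d)"
    by (rule openin_subset) (auto simp: openin_forward_iff[OF assms] intro: exI[of _ 1])
qed

lemma continuous_map_forward_iff:
  assumes "semimetric_on I l" "semimetric_on X d"
  shows "continuous_map (forward_topology I l) (forward_topology X d) P \<longleftrightarrow>
    P \<in> I \<rightarrow> X \<and>
    (\<forall>s\<in>I. \<forall>e>0. \<exists>b>0. \<forall>t\<in>I. l s t < ennreal b \<longrightarrow> d (P s) (P t) < ennreal e)"
    (is "?L \<longleftrightarrow> ?R")
proof
  assume L: ?L
  then have P: "P \<in> I \<rightarrow> X"
    by (simp add: continuous_map_def topspace_forward assms)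
  moreover have "\<exists>b>0. \<forall>t\<in>I. l s t < ennreal b \<longrightarrow> d (P s) (P t) < ennreal e"
    if s: "s \<in> I" "e > 0" for s e
  proof -
    have "openin (forward_topology X d) {y \<in> X. d (P s) y < ennreal e}"
      unfolding forward_topology_def
      by (rule topology_generated_by_Basis) (use that P in blast)
    with L have "openin (forward_topology I l) {t \<in> I. P t \<in> {y \<in> X. d (P s) y < ennreal e}}"
      unfolding continuous_map_def topspace_forward[OF assms(1)] by blast
    moreover have "s \<in> {t \<in> I. P t \<in> {y \<in> X. d (P s) y < ennreal e}}"
      using s P semimetric_zero[OF assms(2)] by (auto simp: Pi_iff)
    ultimately show ?thesis
      unfolding openin_forward_iff[OF assms(1)] by fastforce
  qed
  ultimately show ?R by auto
next
  assume R: ?R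
  show ?L
    unfolding continuous_map_def topspace_forward[OF assms(1)] topspace_forward[OF assms(2)]
  proof (intro conjI allI impI)
    show "P \<in> I \<rightarrow> X" using R by auto
    fix U assume U: "openin (forward_topology X d) U"
    show "openin (forward_topology I l) {x \<in> I. P x \<in> U}"
      unfolding openin_forward_iff[OF assms(1)]
    proof (intro conjI ballI)
      fix s assume "s \<in> {x \<in> I. P x \<in> U}"
      then have s: "s \<in> I" "P s \<in> U" by auto
      obtain e where e: "e > 0" "\<forall>y\<in>X. d (P s) y < ennreal e \<longrightarrow> y \<in> U"
        using U s unfolding openin_forward_iff[OF assms(2)] by blast
      obtain b where "b > 0" "\<forall>t\<in>I. l s t < ennreal b \<longrightarrow> d (P s) (P t) < ennreal e"
        using R s e by blast
      then show "\<exists>e>0. \<forall>y\<in>I. l s y < ennreal e \<longrightarrow> y \<in> {x \<in> I. P x \<in> U}"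
        using e R by (intro exI[of _ b]) auto
    qed auto
  qed
qed

text \<open>
  In the semimetric of the line the out-balls are the intervals \<open>[s, s + b)\<close> and the in-balls the
  intervals \<open>(s - b, s]\<close>. Continuity for the forward topologies is therefore a condition from the
  right, on distances from \<open>P s\<close>, and continuity for the backward topologies one from the left, on
  distances to \<open>P s\<close>.
\<close>

lemma bicontinuous_iff:
  assumes "semimetric_on X d"
  shows "bicontinuous I X d P \<longleftrightarrow> P \<in> I \<rightarrow> X \<and>
    (\<forall>s\<in>I. \<forall>e>0. \<exists>b>0. \<forall>t\<in>I. s \<le> t \<and> t < s + b \<longrightarrow> d (P s) (P t) < ennreal e) \<and>
    (\<forall>s\<in>I. \<forall>e>0. \<exists>b>0. \<forall>t\<in>I. t \<le> s \<and> s < t + b \<longrightarrow> d (P t) (P s) < ennreal e)"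
proof -
  have l: "line_dist s t < ennreal b \<longleftrightarrow> s \<le> t \<and> t < s + b" if "b > 0" for s t b
    using that by (auto simp: line_dist_def ennreal_less_iff)
  show ?thesis
    unfolding bicontinuous_def backward_topology_eq
      continuous_map_forward_iff[OF semimetric_line_dist assms]
      continuous_map_forward_iff[OF semimetric_on_dual[OF semimetric_line_dist]
        semimetric_on_dual[OF assms]]
    by (simp only: l cong: conj_cong) blast
qed

lemma bicontinuous_in:
  "semimetric_on X d \<Longrightarrow> bicontinuous I X d P \<Longrightarrow> t \<in> I \<Longrightarrow> P t \<in> X"
  by (auto simp: bicontinuous_iff)

lemma bicontinuous_forward:
  assumes "semimetric_on X d" "bicontinuous I X d P" "s \<in> I" "0 < e"
  obtains b where "b > 0" "\<And>t. t \<in> I \<Longrightarrow> s \<le> t \<Longrightarrow> t < s + b \<Longrightarrow> d (P s) (P t) < ennreal e"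
proof -
  have "\<forall>s\<in>I. \<forall>e>0. \<exists>b>0. \<forall>t\<in>I. s \<le> t \<and> t < s + b \<longrightarrow> d (P s) (P t) < ennreal e"
    using assms(2) unfolding bicontinuous_iff[OF assms(1)] by (elim conjE)
  then obtain b where "b > 0" "\<forall>t\<in>I. s \<le> t \<and> t < s + b \<longrightarrow> d (P s) (P t) < ennreal e"
    using assms(3,4) by meson
  then show ?thesis using that[of b] by simp
qed

lemma bicontinuous_backward:
  assumes "semimetric_on X d" "bicontinuous I X d P" "s \<in> I" "0 < e"
  obtains b where "b > 0" "\<And>t. t \<in> I \<Longrightarrow> t \<le> s \<Longrightarrow> s < t + b \<Longrightarrow> d (P t) (P s) < ennreal e"
proof -
  have "\<forall>s\<in>I. \<forall>e>0. \<exists>b>0. \<forall>t\<in>I. t \<le> s \<and> s < t + b \<longrightarrow> d (P t) (P s) < ennreal e"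
    using assms(2) unfolding bicontinuous_iff[OF assms(1)] by (elim conjE)
  then obtain b where "b > 0" "\<forall>t\<in>I. t \<le> s \<and> s < t + b \<longrightarrow> d (P t) (P s) < ennreal e"
    using assms(3,4) by meson
  then show ?thesis using that[of b] by simp
qed

lemma bicontinuous_subset:
  assumes "semimetric_on X d" "bicontinuous I X d P" "J \<subseteq> I"
  shows "bicontinuous J X d P"
proof -
  have "\<exists>b>0. \<forall>t\<in>J. s \<le> t \<and> t < s + b \<longrightarrow> d (P s) (P t) < ennreal e"
    if "s \<in> J" "e > 0" for s e
    using bicontinuous_forward[OF assms(1,2), of s e] that assms(3) by (metis subsetD)
  moreover have "\<exists>b>0. \<forall>t\<in>J. t \<le> s \<and> s < t + b \<longrightarrow> d (P t) (P s) < ennreal e"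
    if "s \<in> J" "e > 0" for s e
    using bicontinuous_backward[OF assms(1,2), of s e] that assms(3) by (metis subsetD)
  ultimately show ?thesis
    using assms bicontinuous_in[OF assms(1,2)] by (auto simp: bicontinuous_iff)
qed

text \<open>
  Having finite distance is transitive, and by bicontinuity it holds from \<open>P s\<close> to \<open>P t\<close> whenever
  \<open>s \<le> x \<le> t\<close> with \<open>s\<close> and \<open>t\<close> close to \<open>x\<close>; compactness of \<open>[a, b]\<close> does the rest.
\<close>

lemma bicontinuous_finite_dist:
  assumes X: "semimetric_on X d" and P: "bicontinuous {a..b} X d P" and "a \<le> b"
  shows "d (P a) (P b) < \<infinity>"
proof -
  define fin where "fin = (\<lambda>s t. a \<le> s \<and> t \<le> b \<longrightarrow> d (P s) (P t) < \<infinity>)"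
  have "fin a b"
  proof (rule Bolzano[OF \<open>a \<le> b\<close>])
    fix r s t assume *: "fin r s" "fin s t" "r \<le> s" "s \<le> t"
    show "fin r t"
      unfolding fin_def
    proof
      assume rt: "a \<le> r \<and> t \<le> b"
      then have "d (P r) (P t) \<le> d (P r) (P s) + d (P s) (P t)"
        using * by (intro semimetric_triangle[OF X] bicontinuous_in[OF X P]) auto
      also have "\<dots> < \<infinity>" using * rt by (auto simp: fin_def)
      finally show "d (P r) (P t) < \<infinity>" .
    qed
  next
    fix x assume x: "a \<le> x" "x \<le> b"
    obtain u where u: "u > 0"
      "\<And>t. t \<in> {a..b} \<Longrightarrow> x \<le> t \<Longrightarrow> t < x + u \<Longrightarrow> d (P x) (P t) < ennreal 1"
      using bicontinuous_forward[OF X P, of x 1] x by auto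
    obtain v where v: "v > 0"
      "\<And>t. t \<in> {a..b} \<Longrightarrow> t \<le> x \<Longrightarrow> x < t + v \<Longrightarrow> d (P t) (P x) < ennreal 1"
      using bicontinuous_backward[OF X P, of x 1] x by auto
    show "\<exists>e>0. \<forall>s t. s \<le> x \<and> x \<le> t \<and> t - s < e \<longrightarrow> fin s t"
    proof (intro exI[of _ "min u v"] conjI allI impI)
      fix s t assume st: "s \<le> x \<and> x \<le> t \<and> t - s < min u v"
      show "fin s t"
        unfolding fin_def
      proof
        assume ab: "a \<le> s \<and> t \<le> b"
        then have "d (P s) (P t) \<le> d (P s) (P x) + d (P x) (P t)"
          using st by (intro semimetric_triangle[OF X] bicontinuous_in[OF X P]) auto
        also have "\<dots> < ennreal 1 + ennreal 1"
          using u(2)[of t] v(2)[of s] st ab by (intro add_strict_mono) auto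
        finally show "d (P s) (P t) < \<infinity>" by (simp add: order_less_trans)
      qed
    qed (use u v in auto)
  qed
  then show ?thesis by (simp add: fin_def)
qed

section \<open>Length as the supremum over partitions\<close>

text \<open>
  The approximating sum in the definition of the length, over the partition of \<open>[a, b]\<close> into \<open>N\<close>
  equal parts, indexed from \<open>0\<close> so that it can be cut and telescoped.
\<close>

definition grid_sum :: "('a \<Rightarrow> 'a \<Rightarrow> ennreal) \<Rightarrow> real \<Rightarrow> real \<Rightarrow> (real \<Rightarrow> 'a) \<Rightarrow> nat \<Rightarrow> ennreal" where
  "grid_sum d a b P N =
     (\<Sum>i<N. d (P (a + real i * ((b - a) / real N))) (P (a + real (Suc i) * ((b - a) / real N))))"

lemma path_length_eq_lim: "path_length d (a, b, P) = lim (grid_sum d a b P)"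
proof -
  have "(\<Sum>i=1..N. d (P (a + real (i - 1) * (b - a) / real N)) (P (a + real i * (b - a) / real N)))
     = grid_sum d a b P N" for N
    unfolding grid_sum_def
    by (rule sum.reindex_bij_witness[of _ Suc "\<lambda>i. i - 1"]) auto
  then show ?thesis by simp
qed

lemma dist_le_chain_sum:
  assumes "semimetric_on X d" "\<And>i. m \<le> i \<Longrightarrow> i \<le> n \<Longrightarrow> p i \<in> X" "m \<le> n"
  shows "d (p m) (p n) \<le> (\<Sum>i=m..<n. d (p i) (p (Suc i)))"
  using assms(3,2)
proof (induction n rule: dec_induct)
  case base
  then show ?case using semimetric_zero[OF assms(1), of "p m"] by simp
next
  case (step n)
  have "d (p m) (p (Suc n)) \<le> d (p m) (p n) + d (p n) (p (Suc n))"
    using step by (intro semimetric_triangle[OF assms(1)]) auto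
  also have "\<dots> \<le> (\<Sum>i=m..<n. d (p i) (p (Suc i))) + d (p n) (p (Suc n))"
    using step by (intro add_mono) auto
  finally show ?case using step by simp
qed

text \<open>
  Between two division points \<open>u i < u (i + 1)\<close> a fine grid has points, and the grid points next to
  \<open>u i\<close> on its right and next to \<open>u (i + 1)\<close> on its left are reached at small cost by
  bicontinuity. The triangle inequality then bounds the distance of the two division points by the
  part of the grid sum between them.
\<close>

lemma chain_sum_le_grid_sum:
  assumes X: "semimetric_on X d" and P: "bicontinuous {a..b} X d P" and "a < b"
    and u: "mono_on {..n} u" "\<And>i. i \<le> n \<Longrightarrow> u i \<in> {a..b}"
    and "e > 0"
  shows "\<forall>\<^sub>F N in sequentially. (\<Sum>i<n. d (P (u i)) (P (u (Suc i)))) \<le> grid_sum d a b P N + ennreal e"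
proof -
  define h where "h = (\<lambda>N. (b - a) / real N)"
  define g where "g = (\<lambda>N i. P (a + real i * h N))"
  define l where "l = (\<lambda>N x. nat \<lfloor>(x - a) / h N\<rfloor>)"
  (* The index of the last grid point that is not to the right of x is l N x. *)
  have h_pos: "h N > 0" if "N > 0" for N
    using that \<open>a < b\<close> by (simp add: h_def)
  have l_le: "a + real (l N x) * h N \<le> x" and l_ge: "x < a + real (Suc (l N x)) * h N"
    if "N > 0" "a \<le> x" for N x
  proof -
    have "0 \<le> (x - a) / h N" using h_pos[OF that(1)] that by simp
    then have "real (l N x) \<le> (x - a) / h N" "(x - a) / h N < real (l N x) + 1"
      unfolding l_def by linarith+
    then show "a + real (l N x) * h N \<le> x" "x < a + real (Suc (l N x)) * h N"
      using h_pos[OF that(1)] by (simp_all add: field_simps)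
  qed
  have l_le_N: "l N x \<le> N" if "N > 0" "a \<le> x" "x \<le> b" for N x
  proof -
    have "real (l N x) * h N \<le> real N * h N"
      using l_le[OF that(1,2)] that by (simp add: h_def)
    then show ?thesis using h_pos[OF that(1)] by simp
  qed
  have g_in: "g N i \<in> X" if "N > 0" "i \<le> N" for N i
  proof -
    have "real i * h N \<le> real N * h N" using that h_pos[of N] by simp
    also have "\<dots> = b - a" using that by (simp add: h_def)
    finally show ?thesis
      unfolding g_def using h_pos[OF that(1)] by (intro bicontinuous_in[OF X P]) auto
  qed
  have h_small: "\<forall>\<^sub>F N in sequentially. h N < c" if "c > 0" for c
  proof -
    have "h \<longlonglongrightarrow> 0" unfolding h_def by (rule lim_const_over_n)
    then show ?thesis using that by (rule order_tendstoD)
  qed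
  have main: "\<forall>\<^sub>F N in sequentially. (\<Sum>i<n. d (P (u i)) (P (u (Suc i)))) \<le>
      (\<Sum>j<l N (u n). d (g N j) (g N (Suc j))) + ennreal e"
    (* Counting only the grid steps up to u n keeps the steps used for later parts available. *)
    using u \<open>e > 0\<close>
  proof (induction n arbitrary: e)
    case 0
    then show ?case by simp
  next
    case (Suc n)
    have IH: "\<forall>\<^sub>F N in sequentially. (\<Sum>i<n. d (P (u i)) (P (u (Suc i)))) \<le>
      (\<Sum>j<l N (u n). d (g N j) (g N (Suc j))) + ennreal (e/3)"
      using Suc.prems by (intro Suc.IH) (auto intro: mono_on_subset)
    have un: "u n \<in> {a..b}" "u (Suc n) \<in> {a..b}" "u n \<le> u (Suc n)"
      using Suc.prems by (auto simp: mono_on_def)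
    show ?case
    proof (cases "u n = u (Suc n)")
      case True
      have "d (P (u (Suc n))) (P (u (Suc n))) = 0"
        using semimetric_zero[OF X bicontinuous_in[OF X P un(2)]] .
      moreover have "ennreal (e/3) \<le> ennreal e" using Suc.prems by (intro ennreal_leI) auto
      ultimately show ?thesis
        using IH True by (auto elim!: eventually_mono intro: order_trans add_left_mono)
    next
      case False
      obtain v where v: "v > 0" "\<And>t. t \<in> {a..b} \<Longrightarrow> u n \<le> t \<Longrightarrow> t < u n + v
          \<Longrightarrow> d (P (u n)) (P t) < ennreal (e/3)"
        using bicontinuous_forward[OF X P un(1), of "e/3"] Suc.prems by auto
      obtain w where w: "w > 0" "\<And>t. t \<in> {a..b} \<Longrightarrow> t \<le> u (Suc n) \<Longrightarrow> u (Suc n) < t + w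
          \<Longrightarrow> d (P t) (P (u (Suc n))) < ennreal (e/3)"
        using bicontinuous_backward[OF X P un(2), of "e/3"] Suc.prems by auto
      have "\<forall>\<^sub>F N in sequentially. h N < min (min v w) (u (Suc n) - u n)"
        using v w un False by (intro h_small) auto
      then show ?thesis
        using IH eventually_gt_at_top[of 0]
      proof eventually_elim
        case (elim N)
        define k where "k = Suc (l N (u n))"
        define m where "m = l N (u (Suc n))"
        note N = \<open>0 < N\<close>
        have ln: "a + real (l N (u n)) * h N \<le> u n" "u n < a + real k * h N"
          "a + real m * h N \<le> u (Suc n)" "u (Suc n) < a + real (Suc m) * h N"
          using l_le[OF N, of "u n"] l_ge[OF N, of "u n"] l_le[OF N, of "u (Suc n)"]
            l_ge[OF N, of "u (Suc n)"] un by (auto simp: k_def m_def)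
        have "real k * h N \<le> u (Suc n) - a"
          using ln(1) elim(1) by (simp add: k_def algebra_simps)
        also have "\<dots> < real (Suc m) * h N" using ln by simp
        finally have "k < Suc m" using h_pos[OF N] by simp
        then have "k \<le> m" by simp
        have m: "m \<le> N" using l_le_N[OF N] un by (simp add: m_def)
        have km: "a + real k * h N \<le> a + real m * h N"
          using \<open>k \<le> m\<close> h_pos[OF N] by simp
        have hn: "real (Suc i) * h N = real i * h N + h N" for i by (simp add: algebra_simps)
        have d1: "d (P (u n)) (g N k) \<le> ennreal (e/3)"
          unfolding g_def using ln km elim(1) un hn
          by (rule_tac less_imp_le[OF v(2)]) (auto simp: k_def)
        have d2: "d (g N m) (P (u (Suc n))) \<le> ennreal (e/3)"
          unfolding g_def using ln km elim(1) un hn[of m] h_pos[OF N]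
          by (rule_tac less_imp_le[OF w(2)]) (auto simp: k_def)
        have d3: "d (g N k) (g N m) \<le> (\<Sum>j=k..<m. d (g N j) (g N (Suc j)))"
          using \<open>k \<le> m\<close> m by (intro dist_le_chain_sum[OF X] g_in[OF N]) auto
        have Pu: "P (u n) \<in> X" "P (u (Suc n)) \<in> X" "g N k \<in> X" "g N m \<in> X"
          using un m \<open>k \<le> m\<close> g_in[OF N] bicontinuous_in[OF X P] by auto
        have "d (P (u n)) (P (u (Suc n))) \<le> d (P (u n)) (g N k) + d (g N k) (P (u (Suc n)))"
          using Pu by (intro semimetric_triangle[OF X])
        also have "\<dots> \<le> d (P (u n)) (g N k) + (d (g N k) (g N m) + d (g N m) (P (u (Suc n))))"
          using Pu by (intro semimetric_triangle[OF X] add_left_mono)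
        also have "\<dots> \<le> ennreal (e/3) + ((\<Sum>j=k..<m. d (g N j) (g N (Suc j))) + ennreal (e/3))"
          by (intro add_mono d1 d2 d3)
        finally have step: "d (P (u n)) (P (u (Suc n))) \<le> \<dots>" .
        have "(\<Sum>i<Suc n. d (P (u i)) (P (u (Suc i)))) \<le>
            ((\<Sum>j<l N (u n). d (g N j) (g N (Suc j))) + ennreal (e/3)) +
            (ennreal (e/3) + ((\<Sum>j=k..<m. d (g N j) (g N (Suc j))) + ennreal (e/3)))"
          unfolding sum.lessThan_Suc by (intro add_mono elim(2) step)
        also have "\<dots> = (\<Sum>j<l N (u n). d (g N j) (g N (Suc j))) +
            (\<Sum>j=k..<m. d (g N j) (g N (Suc j))) + (ennreal (e/3) + ennreal (e/3) + ennreal (e/3))"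
          by (simp only: ac_simps)
        also have "ennreal (e/3) + ennreal (e/3) + ennreal (e/3) = ennreal e"
          using Suc.prems by (simp flip: ennreal_plus)
        also have "(\<Sum>j<l N (u n). d (g N j) (g N (Suc j))) +
            (\<Sum>j=k..<m. d (g N j) (g N (Suc j))) \<le>
            (\<Sum>j<k. d (g N j) (g N (Suc j))) + (\<Sum>j=k..<m. d (g N j) (g N (Suc j)))"
          unfolding k_def by (intro add_right_mono sum_mono2) auto
        also have "\<dots> = (\<Sum>j<m. d (g N j) (g N (Suc j)))"
          using \<open>k \<le> m\<close> by (simp add: sum.atLeastLessThan_concat flip: atLeast0LessThan)
        finally show ?case by (simp add: m_def add_right_mono)
      qed
    qed
  qed
  have grid: "grid_sum d a b P N = (\<Sum>j<N. d (g N j) (g N (Suc j)))" for N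
    by (simp add: grid_sum_def g_def h_def)
  show ?thesis
    using main eventually_gt_at_top[of 0]
  proof eventually_elim
    case (elim N)
    have "(\<Sum>j<l N (u n). d (g N j) (g N (Suc j))) \<le> grid_sum d a b P N"
      unfolding grid using l_le_N[OF elim(2), of "u n"] u(2)[of n] by (intro sum_mono2) auto
    with elim(1) show ?case by (meson add_right_mono order_trans)
  qed
qed

text \<open>
  The grid sums converge to their supremum, because each of them is a sum over a partition and hence,
  up to any given error, eventually below the later ones.
\<close>

lemma grid_sum_tendsto:
  assumes X: "semimetric_on X d" and P: "bicontinuous {a..b} X d P" and "a < b"
  shows "grid_sum d a b P \<longlonglongrightarrow> path_length d (a, b, P)"
proof -
  let ?S = "grid_sum d a b P"
  have "?S \<longlonglongrightarrow> (SUP M. ?S M)"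
  proof (rule increasing_tendsto)
    show "\<forall>\<^sub>F N in sequentially. ?S N \<le> (SUP M. ?S M)"
      by (simp add: SUP_upper)
    fix x assume "x < (SUP M. ?S M)"
    then obtain M where M: "x < ?S M" by (auto simp: less_SUP_iff)
    then have "M > 0" by (auto simp: grid_sum_def intro: Nat.gr0I)
    from M obtain e where e: "e > 0" "x + ennreal e < ?S M"
    proof -
      obtain z where z: "x < z" "z < ?S M" using dense[OF M] by auto
      obtain k where k: "0 \<le> k" "x = ennreal k" using z by (cases x) auto
      obtain m where m: "0 \<le> m" "z = ennreal m" using z by (cases z) auto
      have "x + ennreal (m - k) = z" "m - k > 0"
        using z(1) k m by (auto simp: ennreal_less_iff simp flip: ennreal_plus)
      then show ?thesis using that z by blast
    qed
    define u where "u = (\<lambda>i. a + real i * ((b - a) / real M))"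
    have "\<forall>\<^sub>F N in sequentially. (\<Sum>i<M. d (P (u i)) (P (u (Suc i)))) \<le> ?S N + ennreal e"
    proof (rule chain_sum_le_grid_sum[OF X P \<open>a < b\<close> _ _ e(1)])
      show "mono_on {..M} u"
        using \<open>a < b\<close> by (auto simp: mono_on_def u_def intro!: mult_right_mono divide_right_mono)
      fix i assume "i \<le> M"
      then have "real i * ((b - a) / real M) \<le> real M * ((b - a) / real M)"
        using \<open>a < b\<close> by (intro mult_right_mono) auto
      then show "u i \<in> {a..b}" using \<open>M > 0\<close> \<open>a < b\<close> by (auto simp: u_def)
    qed
    then show "\<forall>\<^sub>F N in sequentially. x < ?S N"
    proof eventually_elim
      case (elim N)
      have "(\<Sum>i<M. d (P (u i)) (P (u (Suc i)))) = ?S M"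
        by (simp add: grid_sum_def u_def)
      with elim e(2) have "x + ennreal e < ?S N + ennreal e"
        by (metis order_less_le_trans)
      then show ?case using add_right_mono[of "?S N" x "ennreal e"] by (meson leD leI)
    qed
  qed
  then show ?thesis
    unfolding path_length_eq_lim by (metis limI)
qed

text \<open>
  A sum over a partition is, up to any given error, eventually below the grid sums, hence below their
  limit. All lower bounds on lengths are instances with a suitable partition.
\<close>

lemma chain_sum_le_path_length:
  assumes X: "semimetric_on X d" and P: "bicontinuous {a..b} X d P" and "a < b"
    and u: "mono_on {..n} u" "\<And>i. i \<le> n \<Longrightarrow> u i \<in> {a..b}"
  shows "(\<Sum>i<n. d (P (u i)) (P (u (Suc i)))) \<le> path_length d (a, b, P)"
proof (rule ennreal_le_epsilon)
  fix e :: real assume "0 < e"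
  show "(\<Sum>i<n. d (P (u i)) (P (u (Suc i)))) \<le> path_length d (a, b, P) + ennreal e"
  proof (rule tendsto_lowerbound)
    show "(\<lambda>N. grid_sum d a b P N + ennreal e) \<longlonglongrightarrow> path_length d (a, b, P) + ennreal e"
      by (intro tendsto_add grid_sum_tendsto[OF X P \<open>a < b\<close>] tendsto_const)
    show "\<forall>\<^sub>F N in sequentially. (\<Sum>i<n. d (P (u i)) (P (u (Suc i)))) \<le> grid_sum d a b P N + ennreal e"
      using chain_sum_le_grid_sum[OF X P \<open>a < b\<close> u \<open>0 < e\<close>] .
  qed simp
qed

lemma dist_le_path_length:
  assumes X: "semimetric_on X d" and P: "bicontinuous {a..b} X d P" and "a < b"
  shows "d (P a) (P b) \<le> path_length d (a, b, P)"
  using chain_sum_le_path_length[OF assms, of 1 "\<lambda>i. if i = 0 then a else b"] \<open>a < b\<close>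
  by (simp add: mono_on_def)

lemma three_dists_le_path_length:
  assumes X: "semimetric_on X d" and P: "bicontinuous {a..b} X d P" and "a < b"
    and "a \<le> s" "s \<le> t" "t \<le> b"
  shows "d (P a) (P s) + d (P s) (P t) + d (P t) (P b) \<le> path_length d (a, b, P)"
proof -
  define u where "u = (\<lambda>i::nat. if i = 0 then a else if i = 1 then s else if i = 2 then t else b)"
  have "(\<Sum>i<3. d (P (u i)) (P (u (Suc i)))) \<le> path_length d (a, b, P)"
    by (rule chain_sum_le_path_length[OF X P \<open>a < b\<close>]) (use assms in \<open>auto simp: mono_on_def u_def\<close>)
  moreover have "(\<Sum>i<3. d (P (u i)) (P (u (Suc i)))) = d (P a) (P s) + d (P s) (P t) + d (P t) (P b)"
    by (simp add: numeral_3_eq_3 u_def)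
  ultimately show ?thesis by simp
qed

text \<open>
  Upper bounds on lengths come from a function \<open>F\<close> whose increments dominate the distances, such as
  an arc length parameter: the sum of its increments over any partition telescopes.
\<close>

lemma path_length_le:
  assumes X: "semimetric_on X d" and P: "bicontinuous {a..b} X d P" and "a < b"
    and F: "\<And>s t. a \<le> s \<Longrightarrow> s \<le> t \<Longrightarrow> t \<le> b \<Longrightarrow> F s \<le> F t \<and> d (P s) (P t) \<le> ennreal (F t - F s)"
  shows "path_length d (a, b, P) \<le> ennreal (F b - F a)"
proof (rule tendsto_upperbound[OF grid_sum_tendsto[OF X P \<open>a < b\<close>]])
  show "\<forall>\<^sub>F N in sequentially. grid_sum d a b P N \<le> ennreal (F b - F a)"
    using eventually_gt_at_top[of 0]
  proof eventually_elim
    case (elim N)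
    define v where "v = (\<lambda>i. a + real i * ((b - a) / real N))"
    have v: "a \<le> v i" "v i \<le> v (Suc i)" for i
      using \<open>a < b\<close> by (auto simp: v_def intro!: mult_right_mono divide_right_mono)
    have vN: "v i \<le> b" if "i \<le> N" for i
    proof -
      have "real i * ((b - a) / real N) \<le> real N * ((b - a) / real N)"
        using that \<open>a < b\<close> by (intro mult_right_mono) auto
      then show ?thesis using elim by (simp add: v_def)
    qed
    have "grid_sum d a b P N = (\<Sum>i<N. d (P (v i)) (P (v (Suc i))))"
      by (simp add: grid_sum_def v_def)
    also have "\<dots> \<le> (\<Sum>i<N. ennreal (F (v (Suc i)) - F (v i)))"
      using v vN F by (intro sum_mono) auto
    also have "\<dots> = ennreal (\<Sum>i<N. F (v (Suc i)) - F (v i))"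
      using v vN F by (intro sum_ennreal) auto
    also have "(\<Sum>i<N. F (v (Suc i)) - F (v i)) = F (v N) - F (v 0)"
      by (rule sum_lessThan_telescope)
    also have "\<dots> = F b - F a" using elim by (simp add: v_def)
    finally show ?case .
  qed
qed simp

section \<open>Concatenation of geodesics\<close>

lemma bicontinuous_affine:
  assumes X: "semimetric_on X d" and g: "bicontinuous {a..b} X d g" and "a < b"
  shows "bicontinuous {0..1} X d (\<lambda>s. g (a + s * (b - a)))"
proof -
  have in_ab: "a + s * (b - a) \<in> {a..b}" if "s \<in> {0..1}" for s
  proof -
    define k where "k = s * (b - a)"
    have "0 \<le> k" "k \<le> b - a"
      using that \<open>a < b\<close> by (auto simp: k_def)
    then show ?thesis by (simp flip: k_def)
  qed
  have scale: "s * (b - a) < t * (b - a) + e \<longleftrightarrow> s < t + e / (b - a)" for s t e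
    using \<open>a < b\<close> by (simp add: field_simps)
  have scale_le: "a + s * (b - a) \<le> a + t * (b - a)" if "s \<le> t" for s t
    using \<open>a < b\<close> that by simp
  show ?thesis
    unfolding bicontinuous_iff[OF X]
  proof (intro conjI ballI allI impI)
    show "(\<lambda>s. g (a + s * (b - a))) \<in> {0..1} \<rightarrow> X"
      using bicontinuous_in[OF X g] in_ab by blast
    fix s e :: real assume s: "s \<in> {0..1}" "0 < e"
    obtain u where u: "u > 0" "\<And>t. t \<in> {a..b} \<Longrightarrow> a + s * (b - a) \<le> t \<Longrightarrow> t < a + s * (b - a) + u
        \<Longrightarrow> d (g (a + s * (b - a))) (g t) < ennreal e"
      using bicontinuous_forward[OF X g in_ab[OF s(1)] s(2)] by blast
    show "\<exists>c>0. \<forall>t\<in>{0..1}. s \<le> t \<and> t < s + c \<longrightarrow>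
        d (g (a + s * (b - a))) (g (a + t * (b - a))) < ennreal e"
      using u(1) \<open>a < b\<close> in_ab scale scale_le
      by (intro exI[of _ "u / (b - a)"] conjI ballI impI u(2)) (auto simp: add.assoc)
    obtain v where v: "v > 0" "\<And>t. t \<in> {a..b} \<Longrightarrow> t \<le> a + s * (b - a) \<Longrightarrow> a + s * (b - a) < t + v
        \<Longrightarrow> d (g t) (g (a + s * (b - a))) < ennreal e"
      using bicontinuous_backward[OF X g in_ab[OF s(1)] s(2)] by blast
    show "\<exists>c>0. \<forall>t\<in>{0..1}. t \<le> s \<and> s < t + c \<longrightarrow>
        d (g (a + t * (b - a))) (g (a + s * (b - a))) < ennreal e"
      using v(1) \<open>a < b\<close> in_ab scale scale_le
      by (intro exI[of _ "v / (b - a)"] conjI ballI impI v(2)) (auto simp: add.assoc)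
  qed
qed

text \<open>
  Since the length of a geodesic is the distance of its ends, the lower bound on lengths by
  partitions leaves no slack: intermediate points of a geodesic lie additively between its ends.
\<close>

lemma unit_geodesic:
  assumes X: "semimetric_on X d" and geo: "geodesic_space X d"
    and "x \<in> X" "y \<in> X" "d x y < \<infinity>"
  obtains P where "bicontinuous {0..1} X d P" "P 0 = x" "P 1 = y"
    "\<And>s t. 0 \<le> s \<Longrightarrow> s \<le> t \<Longrightarrow> t \<le> 1 \<Longrightarrow> d x (P s) + d (P s) (P t) + d (P t) y \<le> d x y"
proof -
  obtain p where p: "is_geodesic X d p" "start_point p = x" "end_point p = y"
    using assms(3-) geo unfolding geodesic_space_def by blast
  obtain a b g where abg: "p = (a, b, g)" using prod_cases3 by blast
  have g: "a < b" "bicontinuous {a..b} X d g" "path_length d (a, b, g) = d x y" "g a = x" "g b = y"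
    using p by (auto simp: is_geodesic_def abg simp del: path_length.simps)
  show ?thesis
  proof (rule that[of "\<lambda>s. g (a + s * (b - a))"])
    fix s t :: real assume st: "0 \<le> s" "s \<le> t" "t \<le> 1"
    have "t * (b - a) \<le> b - a" "s * (b - a) \<le> t * (b - a)" "0 \<le> s * (b - a)"
      using st g(1) mult_left_le_one_le[of "b - a" t] by auto
    then show "d x (g (a + s * (b - a))) + d (g (a + s * (b - a))) (g (a + t * (b - a))) +
        d (g (a + t * (b - a))) y \<le> d x y"
      using three_dists_le_path_length[OF X g(2,1), of "a + s * (b - a)" "a + t * (b - a)"] g(3-)
      by simp
  qed (use g bicontinuous_affine[OF X g(2,1)] in auto)
qed

text \<open>
  The geodesics from \<open>y n\<close> to \<open>y (n + 1)\<close> are run through on the intervals \<open>[n, n + 1]\<close>. The function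
  \<open>F\<close> is a majorant for the lengths of subpaths: it pretends that every one of the geodesics has length
  \<open>L\<close> by jumping at the integers, and grows like the distance from \<open>y n\<close> on \<open>[n, n + 1)\<close>.
\<close>

lemma geodesic_concatenation:
  fixes y :: "nat \<Rightarrow> 'a"
  assumes X: "semimetric_on X d" and geo: "geodesic_space X d"
    and y: "\<And>n. y n \<in> X" "\<And>n. d (y n) (y (Suc n)) \<le> ennreal L" and "0 \<le> L"
  obtains Q F where "bicontinuous {0..} X d Q" "\<And>n. Q (real n) = y n"
    "\<And>s t. 0 \<le> s \<Longrightarrow> s \<le> t \<Longrightarrow> F s \<le> F t \<and> d (Q s) (Q t) \<le> ennreal (F t - F s)"
    "\<And>n s. real n \<le> s \<Longrightarrow> s \<le> real (Suc n) \<Longrightarrow> d (y n) (Q s) \<le> ennreal L \<and>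
       d (Q s) (y (Suc n)) \<le> ennreal L \<and> L * real n \<le> F s \<and> F s \<le> L * real (Suc n)"
proof -
  define good where "good = (\<lambda>n P. bicontinuous {0..1} X d P \<and> P 0 = y n \<and> P 1 = y (Suc n) \<and>
    (\<forall>s t. 0 \<le> s \<longrightarrow> s \<le> t \<longrightarrow> t \<le> 1 \<longrightarrow>
      d (y n) (P s) + d (P s) (P t) + d (P t) (y (Suc n)) \<le> d (y n) (y (Suc n))))"
  have "\<exists>P. good n P" for n
  proof -
    have "d (y n) (y (Suc n)) < \<infinity>"
      using y(2)[of n] by (simp add: order_le_less_trans)
    from unit_geodesic[OF X geo y(1) y(1) this] show ?thesis unfolding good_def by metis
  qed
  then obtain P where "\<And>n. good n (P n)" by metis
  then have P: "\<And>n. bicontinuous {0..1} X d (P n)" "\<And>n. P n 0 = y n"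
    "\<And>n. P n 1 = y (Suc n)"
    "\<And>n s t. 0 \<le> s \<Longrightarrow> s \<le> t \<Longrightarrow> t \<le> 1 \<Longrightarrow>
      d (y n) (P n s) + d (P n s) (P n t) + d (P n t) (y (Suc n)) \<le> d (y n) (y (Suc n))"
    unfolding good_def by blast+
  define fl where "fl = (\<lambda>s::real. nat \<lfloor>s\<rfloor>)"
  have fl: "real (fl s) \<le> s" "s < real (Suc (fl s))" if "0 \<le> s" for s
    using that unfolding fl_def by linarith+
  have fl_eq: "fl s = n" if "real n \<le> s" "s < real (Suc n)" for n s
    using that unfolding fl_def by linarith
  define Q where "Q = (\<lambda>s. P (fl s) (s - real (fl s)))"
  have Q: "Q s = P n (s - real n)" if "real n \<le> s" "s \<le> real (Suc n)" for n s
  proof (cases "s = real (Suc n)")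
    case True
    then have "fl s = Suc n" by (intro fl_eq) auto
    with True show ?thesis by (simp add: Q_def P)
  next
    case False
    then have "fl s = n" using that by (intro fl_eq) auto
    then show ?thesis by (simp add: Q_def)
  qed
  have Qn: "Q (real n) = y n" for n
    using Q[of n "real n"] by (simp add: P)
  have QX: "Q s \<in> X" if "0 \<le> s" for s
    using fl[OF that] unfolding Q_def by (intro bicontinuous_in[OF X P(1)]) auto
  define p where "p = (\<lambda>n s. enn2real (d (y n) (Q s)))"
  define q where "q = (\<lambda>n s. enn2real (d (Q s) (y (Suc n))))"
  (* On a single interval the function p n is an arc length parameter for Q. *)
  have piece: "d (y n) (Q s) = ennreal (p n s)" "d (Q s) (y (Suc n)) = ennreal (q n s)"
    "p n s + q n s \<le> L" "p n s \<le> p n t" "d (Q s) (Q t) \<le> ennreal (p n t - p n s)"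
    if st: "real n \<le> s" "s \<le> t" "t \<le> real (Suc n)" for n s t
  proof -
    let ?r = "d (Q s) (Q t)"
    have le: "d (y n) (Q s) + d (Q s) (Q t) + d (Q t) (y (Suc n)) \<le> d (y n) (y (Suc n))"
      if "real n \<le> s" "s \<le> t" "t \<le> real (Suc n)" for s t
      using P(4)[of "s - real n" "t - real n" n] that Q[of n s] Q[of n t] by auto
    have QXs: "Q s \<in> X" "Q t \<in> X" using st by (auto intro!: QX)
    have zero: "d (Q s) (Q s) = 0" "d (Q t) (Q t) = 0" using semimetric_zero[OF X] QXs by auto
    have s1: "d (y n) (Q s) + d (Q s) (y (Suc n)) \<le> ennreal L"
      using le[of s s] st zero y(2)[of n] by simp
    have t1: "d (y n) (Q t) + d (Q t) (y (Suc n)) \<le> ennreal L"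
      using le[of t t] st zero y(2)[of n] by simp
    have fin: "u = ennreal (enn2real u) \<and> v = ennreal (enn2real v) \<and> enn2real u + enn2real v \<le> L"
      if "u + v \<le> ennreal L" for u v
      using that \<open>0 \<le> L\<close> by (cases u; cases v) (auto simp: top_unique simp flip: ennreal_plus)
    show ds: "d (y n) (Q s) = ennreal (p n s)" "d (Q s) (y (Suc n)) = ennreal (q n s)"
      "p n s + q n s \<le> L"
      using fin[OF s1] by (simp_all add: p_def q_def)
    have dt: "d (y n) (Q t) = ennreal (p n t)" "d (Q t) (y (Suc n)) = ennreal (q n t)"
      using fin[OF t1] by (simp_all add: p_def q_def)
    have nn: "0 \<le> p n s" "0 \<le> p n t" "0 \<le> q n t" by (auto simp: p_def q_def)
    have "d (y n) (Q s) + ?r + d (Q t) (y (Suc n)) \<le> d (y n) (y (Suc n))"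
      by (rule le[OF st])
    also have "\<dots> \<le> d (y n) (Q t) + d (Q t) (y (Suc n))"
      using QXs y by (intro semimetric_triangle[OF X])
    finally have *: "ennreal (p n s) + ?r + ennreal (q n t) \<le> ennreal (p n t) + ennreal (q n t)"
      by (simp add: ds dt)
    then obtain k where k: "0 \<le> k" "?r = ennreal k"
      using nn by (cases ?r) (auto simp: top_unique simp flip: ennreal_plus)
    have "p n s + k \<le> p n t"
      using * k nn by (simp flip: ennreal_plus)
    then show "p n s \<le> p n t" "?r \<le> ennreal (p n t - p n s)"
      using k by (auto intro: ennreal_leI)
  qed
  define F where "F = (\<lambda>s. L * real (fl s) + p (fl s) s)"
  have p_nonneg: "0 \<le> p n s" "0 \<le> q n s" for n s by (auto simp: p_def q_def)
  have jump: "d (y m) (y n) \<le> ennreal (L * real (n - m))" if "m \<le> n" for m n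
  proof -
    have "d (y m) (y n) \<le> (\<Sum>i=m..<n. d (y i) (y (Suc i)))"
      using y that by (intro dist_le_chain_sum[OF X]) auto
    also have "\<dots> \<le> (\<Sum>i=m..<n. ennreal L)" by (intro sum_mono y)
    also have "\<dots> = ennreal (L * real (n - m))"
      using \<open>0 \<le> L\<close> by (simp add: ennreal_mult ennreal_of_nat_eq_real_of_nat mult.commute)
    finally show ?thesis .
  qed
  show ?thesis
  proof (rule that[of Q F])
    show "Q (real n) = y n" for n by (rule Qn)
  next
    fix s t :: real assume st: "0 \<le> s" "s \<le> t"
    define m n where "m = fl s" and "n = fl t"
    have m: "real m \<le> s" "s < real (Suc m)" and n: "real n \<le> t" "t < real (Suc n)"
      using fl[of s] fl[of t] st by (auto simp: m_def n_def)
    have "m \<le> n" using m n st by linarith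
    then consider "m = n" | "Suc m \<le> n" by linarith
    then show "F s \<le> F t \<and> d (Q s) (Q t) \<le> ennreal (F t - F s)"
    proof cases
      case 1
      then show ?thesis
        using piece(4,5)[of n s t] m n st by (simp add: F_def flip: m_def n_def)
    next
      case 2
      have s1: "d (Q s) (y (Suc m)) \<le> ennreal (L - p m s)"
        using piece(2,3)[of m s s] m by (auto intro!: ennreal_leI)
      have pL: "0 \<le> L - p m s"
        using piece(3)[of m s s] m p_nonneg(2)[of m s] by auto
      have t1: "d (y n) (Q t) \<le> ennreal (p n t)"
        using piece(1)[of n t t] n by auto
      have "d (Q s) (Q t) \<le> ennreal ((L - p m s) + (L * real (n - Suc m) + p n t))"
        using 2 y QX st pL p_nonneg \<open>0 \<le> L\<close>
        by (intro triangle_bound[OF X _ _ _ s1] triangle_bound[OF X _ _ _ jump t1]) auto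
      also have "(L - p m s) + (L * real (n - Suc m) + p n t) = F t - F s"
        using 2 by (simp add: F_def of_nat_diff algebra_simps flip: m_def n_def)
      finally have "d (Q s) (Q t) \<le> ennreal (F t - F s)" .
      moreover have "0 \<le> F t - F s"
      proof -
        have "F t - F s = (L - p m s) + (L * real (n - Suc m) + p n t)"
          using 2 by (simp add: F_def of_nat_diff algebra_simps flip: m_def n_def)
        then show ?thesis using pL p_nonneg \<open>0 \<le> L\<close> by simp
      qed
      ultimately show ?thesis by simp
    qed
  next
    fix n and s :: real assume s: "real n \<le> s" "s \<le> real (Suc n)"
    have d: "d (y n) (Q s) \<le> ennreal L" "d (Q s) (y (Suc n)) \<le> ennreal L"
      using piece(1-3)[of n s s] s p_nonneg[of n s] by (auto intro!: ennreal_leI)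
    have "L * real n \<le> F s \<and> F s \<le> L * real (Suc n)"
    proof (cases "s = real (Suc n)")
      case True
      then have "fl s = Suc n" by (intro fl_eq) auto
      then show ?thesis
        using True Qn[of "Suc n"] semimetric_zero[OF X y(1)] \<open>0 \<le> L\<close>
        by (simp add: F_def p_def algebra_simps)
    next
      case False
      then have "fl s = n" using s by (intro fl_eq) auto
      then show ?thesis
        using piece(3)[of n s s] s p_nonneg[of n s] by (simp add: F_def algebra_simps)
    qed
    then show "d (y n) (Q s) \<le> ennreal L \<and>
       d (Q s) (y (Suc n)) \<le> ennreal L \<and> L * real n \<le> F s \<and> F s \<le> L * real (Suc n)"
      using d by blast
  next
    show "bicontinuous {0..} X d Q"
      unfolding bicontinuous_iff[OF X]
    proof (intro conjI ballI allI impI)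
      show "Q \<in> {0..} \<rightarrow> X" using QX by auto
      fix s e :: real assume s: "s \<in> {0..}" "0 < e"
      show "\<exists>b>0. \<forall>t\<in>{0..}. s \<le> t \<and> t < s + b \<longrightarrow> d (Q s) (Q t) < ennreal e"
      proof -
        define n where "n = fl s"
        have n: "real n \<le> s" "s < real (Suc n)" using fl[of s] s by (auto simp: n_def)
        obtain u where u: "u > 0" "\<And>t. t \<in> {0..1} \<Longrightarrow> s - real n \<le> t \<Longrightarrow> t < s - real n + u \<Longrightarrow>
            d (P n (s - real n)) (P n t) < ennreal e"
          using bicontinuous_forward[OF X P(1)[of n], of "s - real n" e] s n by auto
        show ?thesis
        proof (intro exI[of _ "min u (real (Suc n) - s)"] conjI ballI impI)
          fix t assume t: "t \<in> {0..}" "s \<le> t \<and> t < s + min u (real (Suc n) - s)"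
          then show "d (Q s) (Q t) < ennreal e"
            using u(2)[of "t - real n"] n Q[of n s] Q[of n t] by auto
        qed (use u n in auto)
      qed
      show "\<exists>b>0. \<forall>t\<in>{0..}. t \<le> s \<and> s < t + b \<longrightarrow> d (Q t) (Q s) < ennreal e"
      proof (cases "s = 0")
        case True
        then show ?thesis using semimetric_zero[OF X QX[of 0]] s
          by (intro exI[of _ 1]) auto
      next
        case False
        define n where "n = nat \<lceil>s\<rceil> - 1"
        have n: "real n < s" "s \<le> real (Suc n)" using s False unfolding n_def by simp_all linarith+
        obtain u where u: "u > 0" "\<And>t. t \<in> {0..1} \<Longrightarrow> t \<le> s - real n \<Longrightarrow> s - real n < t + u \<Longrightarrow>
            d (P n t) (P n (s - real n)) < ennreal e"
          using bicontinuous_backward[OF X P(1)[of n], of "s - real n" e] s n by auto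
        show ?thesis
        proof (intro exI[of _ "min u (s - real n)"] conjI ballI impI)
          fix t assume t: "t \<in> {0..}" "t \<le> s \<and> s < t + min u (s - real n)"
          then show "d (Q t) (Q s) < ennreal e"
            using u(2)[of "t - real n"] n Q[of n s] Q[of n t] by auto
        qed (use u n in auto)
      qed
    qed
  qed
qed

section \<open>Sampling quasi-geodesic rays\<close>

definition qg_ray_with :: "'a set \<Rightarrow> ('a \<Rightarrow> 'a \<Rightarrow> ennreal) \<Rightarrow> real \<Rightarrow> real \<Rightarrow> (real \<Rightarrow> 'a) \<Rightarrow> bool" where
  "qg_ray_with X d \<gamma> c R \<longleftrightarrow> is_ray X d R \<and> \<gamma> \<ge> 1 \<and> c \<ge> 0 \<and>
     (\<forall>a b. 0 \<le> a \<and> a < b \<longrightarrow> quasi_geodesic X d \<gamma> c (a, b, R))"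

lemma qg_rays_iff: "Ray R \<in> qg_rays X d \<longleftrightarrow> (\<exists>\<gamma> c. qg_ray_with X d \<gamma> c R)"
  by (auto simp: qg_rays_def qg_ray_with_def)

context
  fixes X :: "'a set" and d and R \<gamma> c
  assumes X: "semimetric_on X d" and R: "qg_ray_with X d \<gamma> c R"
begin

lemma ray_bicontinuous: "bicontinuous {0..} X d R"
  using R by (simp add: qg_ray_with_def is_ray_def)

lemma ray_bicontinuous_on: "0 \<le> a \<Longrightarrow> bicontinuous {a..b} X d R"
  by (rule bicontinuous_subset[OF X ray_bicontinuous]) auto

lemma ray_in: "0 \<le> s \<Longrightarrow> R s \<in> X"
  by (rule bicontinuous_in[OF X ray_bicontinuous]) auto

lemma ray_length_le:
  assumes "0 \<le> a" "a < b"
  shows "path_length d (a, b, R) \<le> ennreal \<gamma> * d (R a) (R b) + ennreal c"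
proof -
  have "quasi_geodesic X d \<gamma> c (a, b, R)" using R assms by (simp add: qg_ray_with_def)
  then show ?thesis using assms by (simp del: path_length.simps)
qed

text \<open>
  The distance of the ends of a segment is finite, hence by quasi-geodesicity so is its length, which
  bounds the distance from its first point to any of its points and from any of its points to its
  last point.
\<close>

lemma ray_segment_bounded:
  assumes "0 \<le> T"
  obtains k where "0 \<le> k" "\<And>s. 0 \<le> s \<Longrightarrow> s \<le> T \<Longrightarrow> d (R 0) (R s) \<le> ennreal k \<and> d (R s) (R T) \<le> ennreal k"
proof (cases "T = 0")
  case True
  then show ?thesis using that[of 0] semimetric_zero[OF X ray_in[of 0]] by auto
next
  case False
  have "d (R 0) (R T) < \<infinity>"
    using assms by (intro bicontinuous_finite_dist[OF X ray_bicontinuous_on]) auto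
  then have "path_length d (0, T, R) < \<infinity>"
    using ray_length_le[of 0 T] assms False
    by (intro order_le_less_trans[OF ray_length_le[of 0 T]]) (auto simp: ennreal_mult_less_top)
  then obtain k where k: "0 \<le> k" "path_length d (0, T, R) = ennreal k"
    by (rule finite_ennreal_cases)
  show ?thesis
  proof (rule that[OF k(1)])
    fix s assume "0 \<le> s" "s \<le> T"
    then have "d (R 0) (R s) + d (R s) (R s) + d (R s) (R T) \<le> ennreal k"
      unfolding k(2)[symmetric] using assms False
      by (intro three_dists_le_path_length[OF X ray_bicontinuous_on]) auto
    then have "d (R 0) (R s) + d (R s) (R T) \<le> ennreal k"
      using semimetric_zero[OF X ray_in[OF \<open>0 \<le> s\<close>]] by simp
    then show "d (R 0) (R s) \<le> ennreal k \<and> d (R s) (R T) \<le> ennreal k"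
      by (meson add_increasing add_increasing2 order_trans zero_le order_refl le_iff_add)
  qed
qed

lemma ray_leaves_out_ball:
  assumes "x \<in> X"
  obtains T where "0 \<le> T" "\<And>s. T \<le> s \<Longrightarrow> \<not> d x (R s) \<le> ennreal r"
proof -
  obtain p where p: "p \<ge> 0" "R ` {p..} \<inter> out_ball X d (max 0 r) x = {}"
    using R assms unfolding qg_ray_with_def is_ray_def by (meson max.cobounded1)
  show ?thesis
  proof (rule that[OF p(1)])
    fix s assume s: "p \<le> s"
    then have "R s \<notin> out_ball X d (max 0 r) x" using p by blast
    then have "\<not> d x (R s) \<le> ennreal (max 0 r)" using ray_in[of s] s p by (auto simp: out_ball_def)
    moreover have "ennreal r \<le> ennreal (max 0 r)" by (intro ennreal_leI) auto
    ultimately show "\<not> d x (R s) \<le> ennreal r" using order_trans by blast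
  qed
qed

text \<open>
  The ray leaves the out-ball of radius \<open>1\<close> around \<open>R t0\<close>. At the infimum of the times at which
  the distance from \<open>R t0\<close> exceeds \<open>1\<close>, continuity from the left shows that the distance is at
  most \<open>1\<close> and continuity from the right that it is at least \<open>1\<close>.
\<close>

lemma first_exit:
  assumes "0 \<le> t0"
  obtains t1 where "t0 < t1" "d (R t0) (R t1) = 1" "\<And>s. t0 \<le> s \<Longrightarrow> s \<le> t1 \<Longrightarrow> d (R t0) (R s) \<le> 1"
proof -
  define A where "A = {s. t0 \<le> s \<and> 1 < d (R t0) (R s)}"
  obtain T0 where T0: "0 \<le> T0" "\<And>s. T0 \<le> s \<Longrightarrow> \<not> d (R t0) (R s) \<le> ennreal 1"
    using ray_leaves_out_ball[OF ray_in[OF assms]] by blast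
  have "1 < d (R t0) (R (max t0 T0))"
    using T0(2)[of "max t0 T0"] by (simp add: not_le)
  then have "max t0 T0 \<in> A" unfolding A_def using max.cobounded1 by blast
  have bdd: "bdd_below A" by (intro bdd_belowI[of _ t0]) (auto simp: A_def)
  define t1 where "t1 = Inf A"
  have t01: "t0 \<le> t1"
    unfolding t1_def
  proof (rule cInf_greatest)
    show "A \<noteq> {}" using \<open>max t0 T0 \<in> A\<close> by blast
  qed (simp add: A_def)
  have before: "d (R t0) (R s) \<le> 1" if "t0 \<le> s" "s < t1" for s
  proof (rule ccontr)
    assume "\<not> ?thesis"
    then have "s \<in> A" using that by (auto simp: A_def)
    then have "t1 \<le> s" unfolding t1_def by (intro cInf_lower bdd)
    then show False using that by simp
  qed
  have le: "d (R t0) (R t1) \<le> 1"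
  proof (cases "t0 = t1")
    case True
    then show ?thesis using semimetric_zero[OF X ray_in[OF assms]] by simp
  next
    case False
    show ?thesis
    proof (rule ennreal_le_epsilon)
      fix e :: real assume "0 < e"
      then obtain b where b: "b > 0" "\<And>t. t \<in> {0..} \<Longrightarrow> t \<le> t1 \<Longrightarrow> t1 < t + b \<Longrightarrow> d (R t) (R t1) < ennreal e"
        using bicontinuous_backward[OF X ray_bicontinuous, of t1 e] t01 assms by auto
      define s where "s = max t0 (t1 - b / 2)"
      have s: "t0 \<le> s" "s < t1" "t1 < s + b" using b t01 False by (auto simp: s_def max_def)
      have "d (R t0) (R t1) \<le> d (R t0) (R s) + d (R s) (R t1)"
        using s t01 assms by (intro semimetric_triangle[OF X] ray_in) auto
      also have "\<dots> \<le> 1 + ennreal e"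
        using s assms by (intro add_mono before less_imp_le[OF b(2)]) auto
      finally show "d (R t0) (R t1) \<le> 1 + ennreal e" .
    qed
  qed
  have "\<not> d (R t0) (R t1) < 1"
  proof
    assume lt: "d (R t0) (R t1) < 1"
    then obtain k where k: "0 \<le> k" "d (R t0) (R t1) = ennreal k"
      by (cases "d (R t0) (R t1)") (auto simp: top_unique)
    have k1: "k < 1" using lt k by (simp add: ennreal_less_one_iff)
    obtain b where b: "b > 0" "\<And>t. t \<in> {0..} \<Longrightarrow> t1 \<le> t \<Longrightarrow> t < t1 + b \<Longrightarrow> d (R t1) (R t) < ennreal (1 - k)"
      using bicontinuous_forward[OF X ray_bicontinuous, of t1 "1 - k"] t01 assms k1 by auto
    have "t1 + b \<le> Inf A"
    proof (rule cInf_greatest)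
      fix s assume s: "s \<in> A"
      then have "t1 \<le> s" unfolding t1_def by (intro cInf_lower bdd)
      show "t1 + b \<le> s"
      proof (rule ccontr)
        assume "\<not> ?thesis"
        then have "d (R t1) (R s) \<le> ennreal (1 - k)"
          using \<open>t1 \<le> s\<close> t01 assms by (intro less_imp_le[OF b(2)]) auto
        then have "d (R t0) (R s) \<le> ennreal (k + (1 - k))"
          using k k1 \<open>t1 \<le> s\<close> t01 assms by (intro triangle_bound[OF X, of _ _ "R t1"] ray_in) auto
        then show False using s by (auto simp: A_def dest: leD)
      qed
    qed (use \<open>max t0 T0 \<in> A\<close> in auto)
    then show False using b by (simp add: t1_def)
  qed
  then have one: "d (R t0) (R t1) = 1" using le by simp
  then have "t0 \<noteq> t1" using semimetric_zero[OF X ray_in[OF assms]] by auto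
  then show ?thesis
    using that[of t1] t01 one le before by (metis order_le_less)
qed

text \<open>
  Iterating the first exit gives points \<open>R (t n)\<close> at consecutive distance exactly \<open>1\<close>. The length of
  \<open>R\<close> from \<open>t m\<close> to \<open>t n\<close> is then at least \<open>n - m\<close>, so quasi-geodesicity makes the distance of
  \<open>R (t m)\<close> and \<open>R (t n)\<close> grow linearly in \<open>n - m\<close>. As distances on a bounded segment are
  bounded, the times \<open>t n\<close> cannot accumulate.
\<close>

lemma ray_sampling:
  obtains t :: "nat \<Rightarrow> real" where "t 0 = 0" "strict_mono t"
    "\<And>n. d (R (t n)) (R (t (Suc n))) \<le> ennreal 1"
    "\<And>n s. t n \<le> s \<Longrightarrow> s \<le> t (Suc n) \<Longrightarrow>
       d (R (t n)) (R s) \<le> ennreal 1 \<and> d (R s) (R (t (Suc n))) \<le> ennreal (\<gamma> + c)"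
    "\<And>T. \<exists>n. T < t n"
    "\<And>m n. m < n \<Longrightarrow> ennreal (real (n - m)) \<le> ennreal \<gamma> * d (R (t m)) (R (t n)) + ennreal c"
proof -
  define exit where "exit = (\<lambda>t0 t1. t0 < t1 \<and> d (R t0) (R t1) = 1 \<and>
    (\<forall>s. t0 \<le> s \<longrightarrow> s \<le> t1 \<longrightarrow> d (R t0) (R s) \<le> 1))"
  have "\<exists>t. t 0 = 0 \<and> (\<forall>n. 0 \<le> t n \<and> exit (t n) (t (Suc n)))"
  proof -
    have "\<exists>y. 0 \<le> y \<and> exit x y" if "0 \<le> x" for x
    proof -
      obtain y where "exit x y" using first_exit[OF \<open>0 \<le> x\<close>] unfolding exit_def by metis
      then show ?thesis using that by (intro exI[of _ y]) (auto simp: exit_def)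
    qed
    then show ?thesis
      using dependent_nat_choice[of "\<lambda>n x. (n = 0 \<longrightarrow> x = 0) \<and> 0 \<le> x" "\<lambda>n. exit"] by auto
  qed
  then obtain t where t: "t 0 = 0" "\<And>n. 0 \<le> t n" "\<And>n. exit (t n) (t (Suc n))" by auto
  have mono: "strict_mono t"
    using t(3) by (intro strict_monoI_Suc) (auto simp: exit_def)
  have \<gamma>: "\<gamma> \<ge> 1" "c \<ge> 0" using R by (auto simp: qg_ray_with_def)
  have count: "ennreal (real (n - m)) \<le> path_length d (t m, t n, R)" if "m < n" for m n
  proof -
    have tmn: "t m < t n" using mono that by (simp add: strict_mono_less)
    have "(\<Sum>i<n - m. d (R (t (m + i))) (R (t (m + Suc i)))) \<le> path_length d (t m, t n, R)"
      using mono that tmn t(2)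
      by (intro chain_sum_le_path_length[OF X ray_bicontinuous_on, where u = "\<lambda>i. t (m + i)"])
        (auto simp: mono_on_def strict_mono_less_eq)
    moreover have "(\<Sum>i<n - m. d (R (t (m + i))) (R (t (m + Suc i)))) = of_nat (n - m)"
      using t(3) by (simp add: exit_def)
    ultimately show ?thesis by (simp add: ennreal_of_nat_eq_real_of_nat)
  qed
  have sep: "ennreal (real (n - m)) \<le> ennreal \<gamma> * d (R (t m)) (R (t n)) + ennreal c" if "m < n" for m n
    using count[OF that] ray_length_le[of "t m" "t n"] mono that t(2)
    by (meson order_trans strict_mono_less)
  show ?thesis
  proof (rule that[OF t(1) mono _ _ _ sep])
    show "d (R (t n)) (R (t (Suc n))) \<le> ennreal 1" for n
      using t(3)[of n] by (simp add: exit_def)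
  next
    fix n s assume s: "t n \<le> s" "s \<le> t (Suc n)"
    have lt: "t n < t (Suc n)" using t(3)[of n] by (simp add: exit_def)
    have "d (R (t n)) (R s) + d (R s) (R s) + d (R s) (R (t (Suc n))) \<le> path_length d (t n, t (Suc n), R)"
      using s lt t(2) by (intro three_dists_le_path_length[OF X ray_bicontinuous_on]) auto
    also have "\<dots> \<le> ennreal \<gamma> * d (R (t n)) (R (t (Suc n))) + ennreal c"
      using lt t(2) by (intro ray_length_le)
    also have "\<dots> = ennreal (\<gamma> + c)" using t(3)[of n] \<gamma> by (simp add: exit_def)
    finally have "d (R s) (R (t (Suc n))) \<le> ennreal (\<gamma> + c)"
      by (meson add_increasing order_trans zero_le order_refl)
    then show "d (R (t n)) (R s) \<le> ennreal 1 \<and> d (R s) (R (t (Suc n))) \<le> ennreal (\<gamma> + c)"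
      using t(3)[of n] s by (simp add: exit_def)
  next
    fix T
    show "\<exists>n. T < t n"
    proof (rule ccontr)
      assume "\<not> ?thesis"
      then have tT: "t n \<le> T" for n by (simp add: not_less)
      have "0 \<le> T" using tT[of 0] t(1) by simp
      then obtain k where k: "0 \<le> k" "\<And>s. 0 \<le> s \<Longrightarrow> s \<le> T \<Longrightarrow> d (R 0) (R s) \<le> ennreal k"
        using ray_segment_bounded by metis
      obtain n :: nat where n: "real n > \<gamma> * k + c" using reals_Archimedean2 by blast
      moreover have "0 \<le> \<gamma> * k + c" using k \<gamma> by simp
      ultimately have "0 < n" by (intro Nat.gr0I) auto
      have "ennreal (real n) \<le> ennreal \<gamma> * d (R 0) (R (t n)) + ennreal c"
        using sep[OF \<open>0 < n\<close>] t(1) by simp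
      also have "\<dots> \<le> ennreal \<gamma> * ennreal k + ennreal c"
        using k(2) tT t(2) by (intro add_right_mono mult_left_mono) auto
      also have "\<dots> = ennreal (\<gamma> * k + c)" using k \<gamma> by (simp add: ennreal_mult)
      finally have "real n \<le> \<gamma> * k + c" using \<open>0 \<le> \<gamma> * k + c\<close> by (simp add: ennreal_le_iff)
      then show False using n by simp
    qed
  qed
qed

end

section \<open>Quasi-isometries with a quasi-inverse\<close>

text \<open>
  A quasi-isometry together with a quasi-inverse, all constants replaced by a common one. Only upper
  bounds appear, and the two maps enter symmetrically, so every statement about \<open>f\<close> also applies
  to \<open>g\<close>.
\<close>

definition qi_pair ::
    "'a set \<Rightarrow> ('a \<Rightarrow> 'a \<Rightarrow> ennreal) \<Rightarrow> 'b set \<Rightarrow> ('b \<Rightarrow> 'b \<Rightarrow> ennreal) \<Rightarrow> real \<Rightarrow>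
     ('a \<Rightarrow> 'b) \<Rightarrow> ('b \<Rightarrow> 'a) \<Rightarrow> bool" where
  "qi_pair X dX Y dY A f g \<longleftrightarrow> 1 \<le> A \<and> f \<in> X \<rightarrow> Y \<and> g \<in> Y \<rightarrow> X \<and>
     (\<forall>x\<in>X. \<forall>x'\<in>X. dY (f x) (f x') \<le> ennreal A * dX x x' + ennreal A) \<and>
     (\<forall>y\<in>Y. \<forall>y'\<in>Y. dX (g y) (g y') \<le> ennreal A * dY y y' + ennreal A) \<and>
     (\<forall>x\<in>X. dX x (g (f x)) \<le> ennreal A \<and> dX (g (f x)) x \<le> ennreal A) \<and>
     (\<forall>y\<in>Y. dY y (f (g y)) \<le> ennreal A \<and> dY (f (g y)) y \<le> ennreal A)"

lemma qi_pair_sym: "qi_pair X dX Y dY A f g \<Longrightarrow> qi_pair Y dY X dX A g f"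
  unfolding qi_pair_def by blast

lemma qi_pair_dual:
  "qi_pair X dX Y dY A f g \<Longrightarrow> qi_pair X (dual_dist dX) Y (dual_dist dY) A f g"
  unfolding qi_pair_def by blast

lemma qi_pair_in: "qi_pair X dX Y dY A f g \<Longrightarrow> x \<in> X \<Longrightarrow> f x \<in> Y"
  unfolding qi_pair_def by blast

lemma qi_pair_upper:
  assumes "qi_pair X dX Y dY A f g" "x \<in> X" "x' \<in> X" "dX x x' \<le> ennreal k" "0 \<le> k"
  shows "dY (f x) (f x') \<le> ennreal (A * k + A)"
proof -
  have A: "1 \<le> A" using assms by (simp add: qi_pair_def)
  have "dY (f x) (f x') \<le> ennreal A * dX x x' + ennreal A"
    using assms unfolding qi_pair_def by blast
  also have "\<dots> \<le> ennreal A * ennreal k + ennreal A"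
    by (intro add_right_mono mult_left_mono assms) auto
  also have "\<dots> = ennreal (A * k + A)" using A assms(5) by (simp add: ennreal_mult)
  finally show ?thesis .
qed

text \<open>
  The lower bound for \<open>f\<close> is the upper bound for \<open>g\<close>, corrected by the distances between the points
  \<open>x\<close>, \<open>x'\<close> and their images under \<open>g \<circ> f\<close>.
\<close>

lemma qi_pair_lower:
  assumes qi: "qi_pair X dX Y dY A f g" and X: "semimetric_on X dX"
    and "x \<in> X" "x' \<in> X" "dY (f x) (f x') \<le> ennreal k" "0 \<le> k"
  shows "dX x x' \<le> ennreal (A * k + 3 * A)"
proof -
  note qi' = qi_pair_sym[OF qi]
  have A: "1 \<le> A" and gf: "dX x (g (f x)) \<le> ennreal A" "dX (g (f x')) x' \<le> ennreal A"
    using qi assms unfolding qi_pair_def by blast+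
  have "dX (g (f x)) (g (f x')) \<le> ennreal (A * k + A)"
    using assms by (intro qi_pair_upper[OF qi'] qi_pair_in[OF qi]) auto
  then have "dX x x' \<le> ennreal (A + (A * k + A + A))"
    using assms A qi_pair_in[OF qi] qi_pair_in[OF qi']
    by (intro triangle_bound[OF X _ _ _ gf(1) triangle_bound[OF X _ _ _ _ gf(2)]]) auto
  then show ?thesis by (simp add: algebra_simps)
qed

text \<open>
  A quasi-inverse picks a point \<open>g y\<close> whose image is \<open>c\<close>-close to \<open>y\<close> in both directions. Moving \<open>y\<close>
  and \<open>y'\<close> to \<open>f (g y)\<close> and \<open>f (g y')\<close> costs \<open>2 c\<close> and the lower bound for \<open>f\<close> another \<open>c\<close>, each
  multiplied by \<open>\<gamma>\<close>, which is where the summand \<open>3 \<gamma> c\<close> of the common constant comes from.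
\<close>

lemma quasi_isometry_qi_pair:
  assumes X: "semimetric_on X dX" and Y: "semimetric_on Y dY" and "quasi_isometry X dX Y dY f"
  obtains A g where "qi_pair X dX Y dY A f g"
proof -
  obtain \<gamma> c where \<gamma>: "1 \<le> \<gamma>" "0 \<le> c" and f: "f \<in> X \<rightarrow> Y"
    and lower: "\<And>x x'. x \<in> X \<Longrightarrow> x' \<in> X \<Longrightarrow> ennreal (1 / \<gamma>) * dX x x' - ennreal c \<le> dY (f x) (f x')"
    and upper: "\<And>x x'. x \<in> X \<Longrightarrow> x' \<in> X \<Longrightarrow> dY (f x) (f x') \<le> ennreal \<gamma> * dX x x' + ennreal c"
    and surj: "\<forall>y\<in>Y. \<exists>x. x \<in> X \<and> dY (f x) y \<le> ennreal c \<and> dY y (f x) \<le> ennreal c"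
    using assms(3) unfolding quasi_isometry_def by blast
  obtain g where g: "\<And>y. y \<in> Y \<Longrightarrow> g y \<in> X"
    "\<And>y. y \<in> Y \<Longrightarrow> dY (f (g y)) y \<le> ennreal c" "\<And>y. y \<in> Y \<Longrightarrow> dY y (f (g y)) \<le> ennreal c"
    using bchoice[OF surj] by blast
  have fY: "f x \<in> Y" if "x \<in> X" for x using f that by blast
  have low: "dX x x' \<le> ennreal \<gamma> * (dY (f x) (f x') + ennreal c)" if "x \<in> X" "x' \<in> X" for x x'
  proof -
    have "ennreal (1 / \<gamma>) * dX x x' \<le> dY (f x) (f x') + ennreal c"
      using lower[OF that] by (simp add: ennreal_minus_le_iff add.commute)
    then have "ennreal \<gamma> * (ennreal (1 / \<gamma>) * dX x x') \<le> ennreal \<gamma> * (dY (f x) (f x') + ennreal c)"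
      by (intro mult_left_mono) auto
    moreover have "ennreal \<gamma> * (ennreal (1 / \<gamma>) * dX x x') = dX x x'"
      using \<gamma> by (simp add: mult.assoc[symmetric] ennreal_mult[symmetric])
    ultimately show ?thesis by simp
  qed
  define A where "A = \<gamma> + 3 * (\<gamma> * c) + c"
  have gc: "0 \<le> \<gamma> * c" using \<gamma> by simp
  have A: "ennreal \<gamma> \<le> ennreal A" "ennreal c \<le> ennreal A" "ennreal (\<gamma> * (3 * c)) \<le> ennreal A" "1 \<le> A"
  proof -
    have "\<gamma> \<le> A" "c \<le> A" "\<gamma> * (3 * c) \<le> A" "1 \<le> A"
      using \<gamma> gc mult.left_commute[of \<gamma> 3 c] unfolding A_def by linarith+
    then show "ennreal \<gamma> \<le> ennreal A" "ennreal c \<le> ennreal A" "ennreal (\<gamma> * (3 * c)) \<le> ennreal A" "1 \<le> A"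
      by (auto intro: ennreal_leI)
  qed
  have "qi_pair X dX Y dY A f g"
    unfolding qi_pair_def
  proof (intro conjI ballI)
    show "1 \<le> A" by (rule A)
    show "f \<in> X \<rightarrow> Y" by (rule f)
    show "g \<in> Y \<rightarrow> X" using g by blast
    fix x x' assume "x \<in> X" "x' \<in> X"
    then have "dY (f x) (f x') \<le> ennreal \<gamma> * dX x x' + ennreal c" by (rule upper)
    also have "\<dots> \<le> ennreal A * dX x x' + ennreal A"
      by (intro add_mono mult_right_mono A) auto
    finally show "dY (f x) (f x') \<le> ennreal A * dX x x' + ennreal A" .
  next
    fix y y' assume y: "y \<in> Y" "y' \<in> Y"
    have "dY (f (g y)) (f (g y')) \<le> dY (f (g y)) y + (dY y y' + dY y' (f (g y')))"
      by (rule order_trans[OF semimetric_triangle[OF Y, of _ _ y]])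
        (use y g fY in \<open>auto intro!: add_left_mono semimetric_triangle[OF Y]\<close>)
    also have "\<dots> \<le> ennreal c + (dY y y' + ennreal c)"
      using y g by (intro add_mono order_refl) auto
    finally have "ennreal \<gamma> * (dY (f (g y)) (f (g y')) + ennreal c)
      \<le> ennreal \<gamma> * ((ennreal c + (dY y y' + ennreal c)) + ennreal c)"
      by (intro mult_left_mono add_right_mono) auto
    also have "ennreal c + (dY y y' + ennreal c) + ennreal c = dY y y' + ennreal (3 * c)"
      using \<gamma> by (cases "dY y y'") (simp_all flip: ennreal_plus)
    also have "ennreal \<gamma> * (dY y y' + ennreal (3 * c)) = ennreal \<gamma> * dY y y' + ennreal (\<gamma> * (3 * c))"
      using \<gamma> by (simp add: distrib_left ennreal_mult)
    also have "\<dots> \<le> ennreal A * dY y y' + ennreal A"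
      by (intro add_mono mult_right_mono A) auto
    finally show "dX (g y) (g y') \<le> ennreal A * dY y y' + ennreal A"
      using low[of "g y" "g y'"] g y order_trans by blast
  next
    fix y assume "y \<in> Y"
    then show "dY y (f (g y)) \<le> ennreal A" "dY (f (g y)) y \<le> ennreal A"
      using g A order_trans by blast+
  next
    fix x assume x: "x \<in> X"
    have *: "ennreal \<gamma> * (e + ennreal c) \<le> ennreal A" if "e \<le> ennreal c" for e
    proof -
      have "ennreal \<gamma> * (e + ennreal c) \<le> ennreal \<gamma> * (ennreal c + ennreal c)"
        using that by (intro mult_left_mono add_right_mono) auto
      also have "\<dots> = ennreal (\<gamma> * (2 * c))" using \<gamma> by (simp add: ennreal_mult flip: ennreal_plus)
      also have "\<dots> \<le> ennreal A" using \<gamma> gc by (intro ennreal_leI) (simp add: A_def)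
      finally show ?thesis .
    qed
    show "dX x (g (f x)) \<le> ennreal A" "dX (g (f x)) x \<le> ennreal A"
      using x fY[OF x] g[OF fY[OF x]]
      by (auto intro!: order_trans[OF low *])
  qed
  then show ?thesis by (rule that)
qed

lemma follows_iff:
  assumes "Z \<subseteq> X" "ray_points Q \<subseteq> X"
  shows "follows X d Q Z \<longleftrightarrow> (\<exists>K\<ge>0.
    (\<forall>z\<in>Z. (\<exists>q\<in>ray_points Q. d q z \<le> ennreal K) \<and> (\<exists>q\<in>ray_points Q. d z q \<le> ennreal K)) \<and>
    (\<forall>q\<in>ray_points Q. (\<exists>z\<in>Z. d z q \<le> ennreal K) \<and> (\<exists>z\<in>Z. d q z \<le> ennreal K)))"
  using assms unfolding follows_def out_nbhd_def in_nbhd_def out_ball_def in_ball_def subset_eq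
  by fastforce

text \<open>
  Applying \<open>g\<close> to two close points \<open>q\<close> and \<open>f r\<close> gives close points \<open>g q\<close> and \<open>g (f r)\<close>, and
  \<open>g (f r)\<close> is close to \<open>r\<close>. Together with the same statement for \<open>g\<close> this makes the relation
  of following symmetric between the two spaces.
\<close>

lemma follows_inverse:
  assumes X: "semimetric_on X dX" and qi: "qi_pair X dX Y dY A f g"
    and R: "ray_points R \<subseteq> X" and Q: "ray_points Q \<subseteq> Y"
    and "follows Y dY Q (f ` ray_points R)"
  shows "follows X dX R (g ` ray_points Q)"
proof -
  note qi' = qi_pair_sym[OF qi]
  have fR: "f ` ray_points R \<subseteq> Y" and gQ: "g ` ray_points Q \<subseteq> X"
    using R Q qi_pair_in[OF qi] qi_pair_in[OF qi'] by auto
  have A: "1 \<le> A" using qi by (simp add: qi_pair_def)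
  obtain K where K: "K \<ge> 0"
    "\<And>r. r \<in> ray_points R \<Longrightarrow> \<exists>q\<in>ray_points Q. dY q (f r) \<le> ennreal K"
    "\<And>r. r \<in> ray_points R \<Longrightarrow> \<exists>q\<in>ray_points Q. dY (f r) q \<le> ennreal K"
    "\<And>q. q \<in> ray_points Q \<Longrightarrow> \<exists>r\<in>ray_points R. dY (f r) q \<le> ennreal K"
    "\<And>q. q \<in> ray_points Q \<Longrightarrow> \<exists>r\<in>ray_points R. dY q (f r) \<le> ennreal K"
    using assms(5) unfolding follows_iff[OF fR Q] by auto
  define K' where "K' = A * K + A + A"
  have K': "0 \<le> K'" using A K by (simp add: K'_def)
  have to: "dX (g q) r \<le> ennreal K'" if "r \<in> ray_points R" "q \<in> ray_points Q" "dY q (f r) \<le> ennreal K" for r q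
    unfolding K'_def
  proof (rule triangle_bound[OF X, of _ _ "g (f r)"])
    show "dX (g q) (g (f r)) \<le> ennreal (A * K + A)"
      using that R Q K(1) fR by (intro qi_pair_upper[OF qi']) auto
    show "dX (g (f r)) r \<le> ennreal A" using that R qi unfolding qi_pair_def by blast
  qed (use that R Q A K qi_pair_in[OF qi] qi_pair_in[OF qi'] in auto)
  have "from": "dX r (g q) \<le> ennreal K'" if "r \<in> ray_points R" "q \<in> ray_points Q" "dY (f r) q \<le> ennreal K" for r q
  proof -
    have "dX r (g q) \<le> ennreal (A + (A * K + A))"
    proof (rule triangle_bound[OF X, of _ _ "g (f r)"])
      show "dX (g (f r)) (g q) \<le> ennreal (A * K + A)"
        using that R Q K(1) fR by (intro qi_pair_upper[OF qi']) auto
      show "dX r (g (f r)) \<le> ennreal A" using that R qi unfolding qi_pair_def by blast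
    qed (use that R Q A K qi_pair_in[OF qi] qi_pair_in[OF qi'] in auto)
    then show ?thesis by (simp add: K'_def add.commute)
  qed
  show ?thesis
    unfolding follows_iff[OF gQ R]
  proof (intro exI[of _ K'] conjI ballI)
    fix z assume "z \<in> g ` ray_points Q"
    then obtain q where q: "q \<in> ray_points Q" "z = g q" by auto
    show "\<exists>r\<in>ray_points R. dX r z \<le> ennreal K'" "\<exists>r\<in>ray_points R. dX z r \<le> ennreal K'"
      using K(4,5)[OF q(1)] q to "from" by blast+
  next
    fix r assume r: "r \<in> ray_points R"
    show "\<exists>z\<in>g ` ray_points Q. dX z r \<le> ennreal K'" "\<exists>z\<in>g ` ray_points Q. dX r z \<le> ennreal K'"
      using K(2,3)[OF r] r to "from" by blast+
  qed (rule K')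
qed

section \<open>Rays that follow the image of a ray\<close>

text \<open>
  Geodesics in \<open>Y\<close> between consecutive points \<open>y n = f (R (t n))\<close> of the image of a sampling of \<open>R\<close>
  form a quasi-geodesic \<open>Q\<close>. A subpath of \<open>Q\<close> from the \<open>m\<close>-th to the \<open>n\<close>-th geodesic has length at
  most \<open>L (n + 1 - m)\<close>. The number \<open>n + 1 - m\<close> is bounded linearly by the distance from \<open>R (t m)\<close>
  to \<open>R (t (n + 1))\<close>, that by the distance from \<open>y m\<close> to \<open>y (n + 1)\<close>, and that exceeds the
  distance between the ends of the subpath by at most \<open>2 L\<close>.
\<close>

lemma ray_follower:
  assumes X: "semimetric_on X dX" and Y: "semimetric_on Y dY" and geo: "geodesic_space Y dY"
    and qi: "qi_pair X dX Y dY A f g" and R: "qg_ray_with X dX \<gamma> c R"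
  obtains Q \<gamma>' c' where "qg_ray_with Y dY \<gamma>' c' Q" "follows Y dY (Ray Q) (f ` R ` {0..})"
proof -
  obtain t :: "nat \<Rightarrow> real" where t: "t 0 = 0" "strict_mono t"
    "\<And>n. dX (R (t n)) (R (t (Suc n))) \<le> ennreal 1"
    "\<And>n s. t n \<le> s \<Longrightarrow> s \<le> t (Suc n) \<Longrightarrow>
       dX (R (t n)) (R s) \<le> ennreal 1 \<and> dX (R s) (R (t (Suc n))) \<le> ennreal (\<gamma> + c)"
    "\<And>T. \<exists>n. T < t n"
    "\<And>m n. m < n \<Longrightarrow> ennreal (real (n - m)) \<le> ennreal \<gamma> * dX (R (t m)) (R (t n)) + ennreal c"
    using ray_sampling[OF X R] by blast
  have A: "1 \<le> A" using qi by (simp add: qi_pair_def)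
  have \<gamma>: "1 \<le> \<gamma>" "0 \<le> c" using R by (auto simp: qg_ray_with_def)
  have t_nonneg: "0 \<le> t n" for n using t(1) strict_mono_less_eq[OF t(2), of 0 n] by simp
  define x where "x = (\<lambda>n. R (t n))"
  define y where "y = (\<lambda>n. f (x n))"
  define L where "L = A * 1 + A"
  have L: "0 \<le> L" "2 \<le> L" using A by (auto simp: L_def)
  have RX: "R s \<in> X" if "0 \<le> s" for s by (rule ray_in[OF X R that])
  have xX: "x n \<in> X" for n by (simp add: x_def RX t_nonneg)
  have yY: "y n \<in> Y" for n by (simp add: y_def qi_pair_in[OF qi] xX)
  have yL: "dY (y n) (y (Suc n)) \<le> ennreal L" for n
    unfolding y_def L_def using t(3)[of n] xX by (intro qi_pair_upper[OF qi]) (auto simp: x_def)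
  obtain Q F where Q: "bicontinuous {0..} Y dY Q" "\<And>n. Q (real n) = y n"
    "\<And>s t. 0 \<le> s \<Longrightarrow> s \<le> t \<Longrightarrow> F s \<le> F t \<and> dY (Q s) (Q t) \<le> ennreal (F t - F s)"
    "\<And>n s. real n \<le> s \<Longrightarrow> s \<le> real (Suc n) \<Longrightarrow> dY (y n) (Q s) \<le> ennreal L \<and>
       dY (Q s) (y (Suc n)) \<le> ennreal L \<and> L * real n \<le> F s \<and> F s \<le> L * real (Suc n)"
    by (rule geodesic_concatenation[where y = y, OF Y geo yY yL L(1)]) (rule that)
  have QY: "Q s \<in> Y" if "0 \<le> s" for s
    by (rule bicontinuous_in[OF Y Q(1)]) (use that in auto)
  have floor: "\<exists>n. real n \<le> s \<and> s \<le> real (Suc n)" if "0 \<le> s" for s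
    using that by (intro exI[of _ "nat \<lfloor>s\<rfloor>"]) linarith
  (* Points of Q near z force points of the sampling near g z, which R leaves behind. *)
  have "is_ray Y dY Q"
    unfolding is_ray_def
  proof (intro conjI ballI allI impI)
    fix z and r :: real assume z: "z \<in> Y" "0 \<le> r"
    define k where "k = A * (A + (r + L)) + 3 * A"
    have gz: "g z \<in> X" using qi_pair_in[OF qi_pair_sym[OF qi] z(1)] .
    have fgz: "f (g z) \<in> Y" "dY (f (g z)) z \<le> ennreal A"
      using qi_pair_in[OF qi gz] qi z unfolding qi_pair_def by blast+
    obtain T where T: "\<And>s. T \<le> s \<Longrightarrow> \<not> dX (g z) (R s) \<le> ennreal k"
      using ray_leaves_out_ball[OF X R gz] by metis
    obtain N where N: "T < t N" using t(5) by blast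
    have "\<not> dY z (Q s) \<le> ennreal r" if s: "real N \<le> s" for s
    proof
      assume le: "dY z (Q s) \<le> ennreal r"
      have "0 \<le> s" using s by simp
      then obtain n where n: "real n \<le> s" "s \<le> real (Suc n)" using floor by blast
      have "N \<le> Suc n" using s n by linarith
      then have "t N \<le> t (Suc n)" using t(2) by (simp add: strict_mono_less_eq)
      have "dY (f (g z)) (f (x (Suc n))) \<le> ennreal (A + (r + L))"
        using fgz Q(4)[OF n] z QY[OF \<open>0 \<le> s\<close>] yY[of "Suc n"] A L
        unfolding y_def
        by (intro triangle_bound[OF Y _ _ _ fgz(2) triangle_bound[OF Y _ _ _ le]]) auto
      then have "dX (g z) (x (Suc n)) \<le> ennreal k"
        unfolding k_def using gz xX A L z by (intro qi_pair_lower[OF qi X]) auto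
      then show False using T[of "t (Suc n)"] N \<open>t N \<le> t (Suc n)\<close> by (simp add: x_def)
    qed
    then show "\<exists>p\<ge>0. Q ` {p..} \<inter> out_ball Y dY r z = {}"
      by (intro exI[of _ "real N"]) (auto simp: out_ball_def)
  qed (rule Q(1))
  define \<gamma>' where "\<gamma>' = L * \<gamma> * A"
  define c' where "c' = L * (\<gamma> * (A * (2 * L) + 3 * A) + c)"
  have \<gamma>': "1 \<le> \<gamma>'" "0 \<le> c'"
  proof -
    have "1 * 1 * 1 \<le> L * \<gamma> * A" using L \<gamma> A by (intro mult_mono) auto
    then show "1 \<le> \<gamma>'" by (simp add: \<gamma>'_def)
    show "0 \<le> c'" using L \<gamma> A by (auto simp: c'_def)
  qed
  have qg: "path_length dY (s, s', Q) \<le> ennreal \<gamma>' * dY (Q s) (Q s') + ennreal c'"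
    if s: "0 \<le> s" "s < s'" for s s'
  proof (cases "dY (Q s) (Q s') = \<infinity>")
    case True
    then show ?thesis using \<gamma>' by (simp add: ennreal_mult_top)
  next
    case False
    then obtain k where k: "0 \<le> k" "dY (Q s) (Q s') = ennreal k"
      by (cases "dY (Q s) (Q s')") auto
    obtain m where m: "real m \<le> s" "s \<le> real (Suc m)" using floor s by blast
    obtain n where n: "real n \<le> s'" "s' \<le> real (Suc n)" using floor[of s'] s by auto
    have mn: "m < Suc n" using m n s by linarith
    have "dY (y m) (y (Suc n)) \<le> ennreal (L + (k + L))"
    proof (rule triangle_bound[OF Y])
      show "dY (y m) (Q s) \<le> ennreal L" using Q(4)[OF m] by blast
      show "dY (Q s) (y (Suc n)) \<le> ennreal (k + L)"
      proof (rule triangle_bound[OF Y])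
        show "dY (Q s) (Q s') \<le> ennreal k" by (simp add: k)
        show "dY (Q s') (y (Suc n)) \<le> ennreal L" using Q(4)[OF n] by blast
      qed (use k s L yY QY in auto)
    qed (use k s L yY QY in auto)
    then have dx: "dX (x m) (x (Suc n)) \<le> ennreal (A * (L + (k + L)) + 3 * A)"
      unfolding y_def using k L xX by (intro qi_pair_lower[OF qi X]) auto
    have "ennreal (real (Suc n - m)) \<le> ennreal \<gamma> * dX (x m) (x (Suc n)) + ennreal c"
      using t(6)[OF mn] by (simp add: x_def)
    also have "\<dots> \<le> ennreal \<gamma> * ennreal (A * (L + (k + L)) + 3 * A) + ennreal c"
      by (intro add_right_mono mult_left_mono dx) auto
    also have "\<dots> = ennreal (\<gamma> * (A * (L + (k + L)) + 3 * A) + c)"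
      using A L k \<gamma> by (simp add: ennreal_mult)
    finally have count: "real (Suc n - m) \<le> \<gamma> * (A * (L + (k + L)) + 3 * A) + c"
      using A L k \<gamma> by (subst (asm) ennreal_le_iff) auto
    have "path_length dY (s, s', Q) \<le> ennreal (F s' - F s)"
      using s Q(3) by (intro path_length_le[OF Y bicontinuous_subset[OF Y Q(1)]]) auto
    also have "F s' - F s \<le> L * real (Suc n) - L * real m"
      using Q(4)[OF m] Q(4)[OF n] by (intro diff_mono) auto
    also have "\<dots> = L * real (Suc n - m)"
      using mn by (simp add: of_nat_diff algebra_simps)
    also have "\<dots> \<le> L * (\<gamma> * (A * (L + (k + L)) + 3 * A) + c)"
      by (rule mult_left_mono[OF count L(1)])
    also have "\<dots> = \<gamma>' * k + c'"
      by (simp add: \<gamma>'_def c'_def algebra_simps)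
    finally show ?thesis
      using \<gamma>' k by (simp add: ennreal_mult ennreal_leI del: path_length.simps)
  qed
  have "qg_ray_with Y dY \<gamma>' c' Q"
    unfolding qg_ray_with_def
  proof (intro conjI allI impI)
    fix a b :: real assume ab: "0 \<le> a \<and> a < b"
    have "bicontinuous {a..b} Y dY Q"
      by (rule bicontinuous_subset[OF Y Q(1)]) (use ab in auto)
    then show "quasi_geodesic Y dY \<gamma>' c' (a, b, Q)"
      using ab qg by (auto simp del: path_length.simps)
  qed (use \<gamma>' \<open>is_ray Y dY Q\<close> in auto)
  moreover have "follows Y dY (Ray Q) (f ` R ` {0..})"
  proof -
    define K where "K = L + (A * (\<gamma> + c) + A)"
    have "L \<le> K" "A * (\<gamma> + c) + A \<le> K" "0 \<le> K" using A L \<gamma> by (auto simp: K_def)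
    then have K: "ennreal L \<le> ennreal K" "ennreal (A * (\<gamma> + c) + A) \<le> ennreal K" "0 \<le> K"
      by (auto intro: ennreal_leI)
    have sub: "f ` R ` {0..} \<subseteq> Y" "ray_points (Ray Q) \<subseteq> Y"
      using qi_pair_in[OF qi] RX QY by auto
    show ?thesis
      unfolding follows_iff[OF sub]
    proof (intro exI[of _ K] conjI ballI)
      fix z assume "z \<in> f ` R ` {0..}"
      then obtain s where s: "0 \<le> s" "z = f (R s)" by auto
      define N where "N = (LEAST n. s < t n)"
      have N: "s < t N" unfolding N_def using t(5)[of s] by (rule LeastI_ex)
      then have "N \<noteq> 0" using t(1) s by (intro notI) simp
      then obtain n where n: "N = Suc n" using not0_implies_Suc by blast
      have "\<not> s < t n" using not_less_Least[of n "\<lambda>n. s < t n"] n by (simp add: N_def)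
      then have s': "t n \<le> s" "s \<le> t (Suc n)" using N n by auto
      have "dY (y n) z \<le> ennreal L"
        unfolding y_def L_def s x_def using t(4)[OF s'] t_nonneg s RX by (intro qi_pair_upper[OF qi]) auto
      moreover have "dY z (y (Suc n)) \<le> ennreal (A * (\<gamma> + c) + A)"
        unfolding y_def s x_def using t(4)[OF s'] t_nonneg s RX \<gamma> by (intro qi_pair_upper[OF qi]) auto
      moreover have "y i \<in> ray_points (Ray Q)" for i
        using Q(2)[of i] by (metis atLeast_iff imageI of_nat_0_le_iff ray_points.simps(1))
      ultimately show "\<exists>q\<in>ray_points (Ray Q). dY q z \<le> ennreal K" "\<exists>q\<in>ray_points (Ray Q). dY z q \<le> ennreal K"
        using K order_trans by blast+
    next
      fix q assume "q \<in> ray_points (Ray Q)"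
      then obtain s where s: "0 \<le> s" "q = Q s" by auto
      then obtain n where n: "real n \<le> s" "s \<le> real (Suc n)" using floor by blast
      have "y i \<in> f ` R ` {0..}" for i using t_nonneg by (auto simp: y_def x_def)
      then show "\<exists>z\<in>f ` R ` {0..}. dY z q \<le> ennreal K" "\<exists>z\<in>f ` R ` {0..}. dY q z \<le> ennreal K"
        using Q(4)[OF n] K order_trans unfolding s by blast+
    qed (rule K)
  qed
  ultimately show ?thesis by (rule that)
qed

section \<open>Reversal of paths and rays\<close>

lemma bicontinuous_dual:
  assumes X: "semimetric_on X d" and R: "bicontinuous I X d R"
  shows "bicontinuous (uminus ` I) X (dual_dist d) (\<lambda>s. R (- s))"
  unfolding bicontinuous_iff[OF semimetric_on_dual[OF X]]
proof (intro conjI ballI allI impI)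
  show "(\<lambda>s. R (- s)) \<in> uminus ` I \<rightarrow> X"
    using bicontinuous_in[OF X R] by auto
  fix s e :: real assume s: "s \<in> uminus ` I" "0 < e"
  then have "- s \<in> I" by auto
  obtain u where u: "u > 0" "\<And>t. t \<in> I \<Longrightarrow> t \<le> - s \<Longrightarrow> - s < t + u \<Longrightarrow> d (R t) (R (- s)) < ennreal e"
    using bicontinuous_backward[OF X R \<open>- s \<in> I\<close> s(2)] by blast
  show "\<exists>b>0. \<forall>t\<in>uminus ` I. s \<le> t \<and> t < s + b \<longrightarrow> d (R (- t)) (R (- s)) < ennreal e"
    using u by (intro exI[of _ u]) auto
  obtain v where v: "v > 0" "\<And>t. t \<in> I \<Longrightarrow> - s \<le> t \<Longrightarrow> t < - s + v \<Longrightarrow> d (R (- s)) (R t) < ennreal e"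
    using bicontinuous_forward[OF X R \<open>- s \<in> I\<close> s(2)] by blast
  show "\<exists>b>0. \<forall>t\<in>uminus ` I. t \<le> s \<and> s < t + b \<longrightarrow> d (R (- s)) (R (- t)) < ennreal e"
    using v by (intro exI[of _ v]) auto
qed

text \<open>
  The two lengths are limits of the same sums, with the summands in opposite order.
\<close>

lemma path_length_dual: "path_length (dual_dist d) (- b, - a, \<lambda>s. R (- s)) = path_length d (a, b, R)"
proof -
  have "grid_sum (dual_dist d) (- b) (- a) (\<lambda>s. R (- s)) N = grid_sum d a b R N" for N
  proof -
    define h where "h = (b - a) / real N"
    have flip: "- (- b + real i * h) = a + real (N - i) * h" if "i \<le> N" "0 < N" for i
      using that by (simp add: h_def of_nat_diff field_simps)
    have "grid_sum (dual_dist d) (- b) (- a) (\<lambda>s. R (- s)) N =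
        (\<Sum>i<N. d (R (- (- b + real (Suc i) * h))) (R (- (- b + real i * h))))"
      by (simp add: grid_sum_def h_def)
    also have "\<dots> = (\<Sum>i<N. d (R (a + real (N - Suc i) * h)) (R (a + real (Suc (N - Suc i)) * h)))"
    proof (rule sum.cong[OF refl])
      fix i assume "i \<in> {..<N}"
      then have "Suc i \<le> N" "i \<le> N" "0 < N" "Suc (N - Suc i) = N - i" by auto
      then show "d (R (- (- b + real (Suc i) * h))) (R (- (- b + real i * h))) =
          d (R (a + real (N - Suc i) * h)) (R (a + real (Suc (N - Suc i)) * h))"
        using flip by presburger
    qed
    also have "\<dots> = (\<Sum>i<N. d (R (a + real i * h)) (R (a + real (Suc i) * h)))"
      by (rule sum.nat_diff_reindex)
    finally show ?thesis by (simp add: grid_sum_def h_def)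
  qed
  then show ?thesis unfolding path_length_eq_lim by presburger
qed

lemma quasi_geodesic_dual:
  assumes X: "semimetric_on X d" and "quasi_geodesic X d \<gamma> c (a, b, R)"
  shows "quasi_geodesic X (dual_dist d) \<gamma> c (- b, - a, \<lambda>s. R (- s))"
proof -
  have R: "a < b" "bicontinuous {a..b} X d R"
    "\<And>s t. a \<le> s \<Longrightarrow> s < t \<Longrightarrow> t \<le> b \<Longrightarrow> path_length d (s, t, R) \<le> ennreal \<gamma> * d (R s) (R t) + ennreal c"
    using assms(2) by (auto simp del: path_length.simps)
  have "path_length (dual_dist d) (s, t, \<lambda>s. R (- s)) \<le> ennreal \<gamma> * d (R (- t)) (R (- s)) + ennreal c"
    if "- b \<le> s" "s < t" "t \<le> - a" for s t
    using R(3)[of "- t" "- s"] path_length_dual[of d "- s" "- t" R] that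
    by (simp del: path_length.simps)
  moreover have "bicontinuous {- b..- a} X (dual_dist d) (\<lambda>s. R (- s))"
    using bicontinuous_dual[OF X R(2)] by simp
  ultimately show ?thesis using R(1) by (simp del: path_length.simps)
qed

lemma anti_ray_dual:
  assumes X: "semimetric_on X d"
  shows "Anti_Ray R \<in> qg_anti_rays X d \<longleftrightarrow> Ray (\<lambda>s. R (- s)) \<in> qg_rays X (dual_dist d)"
proof
  assume "Anti_Ray R \<in> qg_anti_rays X d"
  then obtain \<gamma> c where R: "is_anti_ray X d R" "\<gamma> \<ge> 1" "c \<ge> 0"
    "\<And>a b. a < b \<Longrightarrow> b \<le> 0 \<Longrightarrow> quasi_geodesic X d \<gamma> c (a, b, R)"
    by (auto simp: qg_anti_rays_def)
  have "quasi_geodesic X (dual_dist d) \<gamma> c (a, b, \<lambda>s. R (- s))" if "0 \<le> a" "a < b" for a b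
    using quasi_geodesic_dual[OF X R(4)[of "- b" "- a"]] that
    by (simp del: quasi_geodesic.simps)
  moreover have "is_ray X (dual_dist d) (\<lambda>s. R (- s))"
    unfolding is_ray_def
  proof (intro conjI ballI allI impI)
    show "bicontinuous {0..} X (dual_dist d) (\<lambda>s. R (- s))"
      using bicontinuous_dual[OF X, of "{..0}" R] R(1) by (simp add: is_anti_ray_def)
    fix x and r :: real assume "x \<in> X" "0 \<le> r"
    then obtain p where p: "p \<le> 0" "R ` {..p} \<inter> in_ball X d r x = {}"
      using R(1) unfolding is_anti_ray_def by blast
    have "(\<lambda>s. R (- s)) ` {- p..} \<subseteq> R ` {..p}" by auto
    then show "\<exists>p\<ge>0. (\<lambda>s. R (- s)) ` {p..} \<inter> out_ball X (dual_dist d) r x = {}"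
      using p by (intro exI[of _ "- p"]) (auto simp: in_ball_def out_ball_def)
  qed
  ultimately show "Ray (\<lambda>s. R (- s)) \<in> qg_rays X (dual_dist d)"
    using R(2,3) unfolding qg_rays_def by blast
next
  note X' = semimetric_on_dual[OF X]
  assume "Ray (\<lambda>s. R (- s)) \<in> qg_rays X (dual_dist d)"
  then obtain \<gamma> c where R: "is_ray X (dual_dist d) (\<lambda>s. R (- s))" "\<gamma> \<ge> 1" "c \<ge> 0"
    "\<And>a b. 0 \<le> a \<Longrightarrow> a < b \<Longrightarrow> quasi_geodesic X (dual_dist d) \<gamma> c (a, b, \<lambda>s. R (- s))"
    by (auto simp: qg_rays_def)
  have "quasi_geodesic X d \<gamma> c (a, b, R)" if "a < b" "b \<le> 0" for a b
    using quasi_geodesic_dual[OF X' R(4)[of "- b" "- a"]] that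
    by (simp del: quasi_geodesic.simps)
  moreover have "is_anti_ray X d R"
    unfolding is_anti_ray_def
  proof (intro conjI ballI allI impI)
    show "bicontinuous {..0} X d R"
      using bicontinuous_dual[OF X', of "{0..}" "\<lambda>s. R (- s)"] R(1) by (simp add: is_ray_def)
    fix x and r :: real assume "x \<in> X" "0 \<le> r"
    then obtain p where p: "p \<ge> 0" "(\<lambda>s. R (- s)) ` {p..} \<inter> out_ball X (dual_dist d) r x = {}"
      using R(1) unfolding is_ray_def by blast
    have "R s \<in> (\<lambda>s. R (- s)) ` {p..}" if "s \<le> - p" for s
      using that by (intro image_eqI[of _ _ "- s"]) auto
    then have "R ` {..- p} \<subseteq> (\<lambda>s. R (- s)) ` {p..}" by blast
    then show "\<exists>p\<le>0. R ` {..p} \<inter> in_ball X d r x = {}"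
      using p by (intro exI[of _ "- p"]) (auto simp: in_ball_def out_ball_def)
  qed
  ultimately show "Anti_Ray R \<in> qg_anti_rays X d"
    using R(2,3) unfolding qg_anti_rays_def by blast
qed

lemma cond_B2_dual: "cond_B1 X d \<Longrightarrow> cond_B2 X (dual_dist d)"
  unfolding cond_B1_def cond_B2_def in_ball_def out_ball_def by blast

lemma geodesic_space_dual:
  assumes X: "semimetric_on X d" and "geodesic_space X d"
  shows "geodesic_space X (dual_dist d)"
  unfolding geodesic_space_def
proof (intro ballI impI)
  fix x y assume xy: "x \<in> X" "y \<in> X" "d y x < \<infinity>"
  then obtain p where p: "is_geodesic X d p" "start_point p = y" "end_point p = x"
    using assms(2) unfolding geodesic_space_def by blast
  obtain a b g where abg: "p = (a, b, g)" using prod_cases3 by blast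
  have g: "a < b" "bicontinuous {a..b} X d g" "path_length d (a, b, g) = d y x" "g a = y" "g b = x"
    using p by (auto simp: is_geodesic_def abg simp del: path_length.simps)
  have "bicontinuous {- b..- a} X (dual_dist d) (\<lambda>s. g (- s))"
    using bicontinuous_dual[OF X g(2)] by simp
  then have "is_geodesic X (dual_dist d) (- b, - a, \<lambda>s. g (- s))"
    using g path_length_dual[of d b a g] by (simp add: is_geodesic_def del: path_length.simps)
  then show "\<exists>p. is_geodesic X (dual_dist d) p \<and> start_point p = x \<and> end_point p = y"
    using g by (intro exI[of _ "(- b, - a, \<lambda>s. g (- s))"]) simp
qed

section \<open>Points far out on rays and anti-rays\<close>

text \<open>
  What the comparison of two ends uses of a quasi-geodesic ray or of an anti-ray parametrised by
  \<open>[0, \<infinity>)\<close>: it leaves all balls of both kinds, and each initial segment lies in an out-ball and in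
  an in-ball. The definition is invariant under swapping the arguments of the distance.
\<close>

definition tame_end :: "'a set \<Rightarrow> ('a \<Rightarrow> 'a \<Rightarrow> ennreal) \<Rightarrow> (real \<Rightarrow> 'a) \<Rightarrow> bool" where
  "tame_end X d \<rho> \<longleftrightarrow> (\<forall>u\<ge>0. \<rho> u \<in> X) \<and>
     (\<forall>x\<in>X. \<forall>r. \<exists>T. \<forall>u\<ge>T. \<not> d x (\<rho> u) \<le> ennreal r) \<and>
     (\<forall>x\<in>X. \<forall>r. \<exists>T. \<forall>u\<ge>T. \<not> d (\<rho> u) x \<le> ennreal r) \<and>
     (\<forall>T\<ge>0. \<exists>x\<in>X. \<exists>k\<ge>0. \<forall>u. 0 \<le> u \<and> u \<le> T \<longrightarrow> d x (\<rho> u) \<le> ennreal k) \<and>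
     (\<forall>T\<ge>0. \<exists>x\<in>X. \<exists>k\<ge>0. \<forall>u. 0 \<le> u \<and> u \<le> T \<longrightarrow> d (\<rho> u) x \<le> ennreal k)"

lemma tame_end_dual: "tame_end X (dual_dist d) \<rho> \<Longrightarrow> tame_end X d \<rho>"
  unfolding tame_end_def by (elim conjE) (intro conjI; assumption)

lemma tame_end_in: "tame_end X d \<rho> \<Longrightarrow> 0 \<le> u \<Longrightarrow> \<rho> u \<in> X"
  unfolding tame_end_def by (elim conjE) blast

lemma tame_end_far_from:
  assumes "tame_end X d \<rho>" "x \<in> X"
  obtains T where "\<And>u. T \<le> u \<Longrightarrow> \<not> d x (\<rho> u) \<le> ennreal r"
proof -
  have "\<forall>x\<in>X. \<forall>r. \<exists>T. \<forall>u\<ge>T. \<not> d x (\<rho> u) \<le> ennreal r"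
    using assms(1) unfolding tame_end_def by (elim conjE)
  then show ?thesis using assms(2) that by meson
qed

lemma tame_end_far_to:
  assumes "tame_end X d \<rho>" "x \<in> X"
  obtains T where "\<And>u. T \<le> u \<Longrightarrow> \<not> d (\<rho> u) x \<le> ennreal r"
proof -
  have "\<forall>x\<in>X. \<forall>r. \<exists>T. \<forall>u\<ge>T. \<not> d (\<rho> u) x \<le> ennreal r"
    using assms(1) unfolding tame_end_def by (elim conjE)
  then show ?thesis using assms(2) that by meson
qed

lemma tame_end_bounded_from:
  assumes "tame_end X d \<rho>" "0 \<le> T"
  obtains x k where "x \<in> X" "0 \<le> k" "\<And>u. 0 \<le> u \<Longrightarrow> u \<le> T \<Longrightarrow> d x (\<rho> u) \<le> ennreal k"
proof -
  have "\<forall>T\<ge>0. \<exists>x\<in>X. \<exists>k\<ge>0. \<forall>u. 0 \<le> u \<and> u \<le> T \<longrightarrow> d x (\<rho> u) \<le> ennreal k"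
    using assms(1) unfolding tame_end_def by (elim conjE)
  then show ?thesis using assms(2) that by meson
qed

lemma tame_end_bounded_to:
  assumes "tame_end X d \<rho>" "0 \<le> T"
  obtains x k where "x \<in> X" "0 \<le> k" "\<And>u. 0 \<le> u \<Longrightarrow> u \<le> T \<Longrightarrow> d (\<rho> u) x \<le> ennreal k"
proof -
  have "\<forall>T\<ge>0. \<exists>x\<in>X. \<exists>k\<ge>0. \<forall>u. 0 \<le> u \<and> u \<le> T \<longrightarrow> d (\<rho> u) x \<le> ennreal k"
    using assms(1) unfolding tame_end_def by (elim conjE)
  then show ?thesis using assms(2) that by meson
qed

text \<open>
  A ray leaves all out-balls by definition. If it met an in-ball around \<open>x\<close> at a time \<open>s\<close> and at
  arbitrarily late times \<open>u\<close>, then, the distance from \<open>R s\<close> to \<open>R u\<close> being finite, condition (B2)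
  would bound it, so \<open>R\<close> would not leave an out-ball around \<open>R s\<close>.
\<close>

lemma tame_ray:
  assumes X: "semimetric_on X d" and B2: "cond_B2 X d" and "Ray R \<in> qg_rays X d"
  shows "tame_end X d R"
proof -
  obtain \<gamma> c where R: "qg_ray_with X d \<gamma> c R" using assms(3) qg_rays_iff by blast
  note RX = ray_in[OF X R]
  obtain h :: "real \<Rightarrow> real" where h: "\<And>x r y z. x \<in> X \<Longrightarrow> 0 \<le> r \<Longrightarrow> y \<in> in_ball X d r x \<Longrightarrow>
      z \<in> in_ball X d r x \<Longrightarrow> d y z = \<infinity> \<or> d y z \<le> ennreal (h r)"
    using B2 unfolding cond_B2_def by blast
  have "\<exists>T. \<forall>u\<ge>T. \<not> d (R u) x \<le> ennreal r" if x: "x \<in> X" for x r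
  proof (cases "\<exists>s\<ge>0. d (R s) x \<le> ennreal (max 0 r)")
    case False
    have "ennreal r \<le> ennreal (max 0 r)" by (intro ennreal_leI) auto
    with False show ?thesis by (intro exI[of _ 0]) (meson order_trans)
  next
    case True
    then obtain s where s: "0 \<le> s" "d (R s) x \<le> ennreal (max 0 r)" by blast
    obtain T where T: "\<And>u. T \<le> u \<Longrightarrow> \<not> d (R s) (R u) \<le> ennreal (h (max 0 r))"
      using ray_leaves_out_ball[OF X R RX[OF s(1)]] by metis
    have "\<not> d (R u) x \<le> ennreal r" if u: "max T s \<le> u" for u
    proof
      assume "d (R u) x \<le> ennreal r"
      also have "ennreal r \<le> ennreal (max 0 r)" by (intro ennreal_leI) auto
      finally have "d (R u) x \<le> ennreal (max 0 r)" .
      then have "d (R s) (R u) = \<infinity> \<or> d (R s) (R u) \<le> ennreal (h (max 0 r))"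
        using s u x RX by (intro h[OF x]) (auto simp: in_ball_def)
      moreover have "d (R s) (R u) < \<infinity>"
        using s u by (intro bicontinuous_finite_dist[OF X ray_bicontinuous_on[OF X R]]) auto
      ultimately show False using T[of u] u by auto
    qed
    then show ?thesis by blast
  qed
  moreover have "\<exists>T. \<forall>u\<ge>T. \<not> d x (R u) \<le> ennreal r" if "x \<in> X" for x r
    using ray_leaves_out_ball[OF X R that] by metis
  moreover have "\<exists>x\<in>X. \<exists>k\<ge>0. \<forall>u. 0 \<le> u \<and> u \<le> T \<longrightarrow> d x (R u) \<le> ennreal k"
    "\<exists>x\<in>X. \<exists>k\<ge>0. \<forall>u. 0 \<le> u \<and> u \<le> T \<longrightarrow> d (R u) x \<le> ennreal k" if "0 \<le> T" for T
    using ray_segment_bounded[OF X R that] RX[of 0] RX[OF that] by (metis order_refl)+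
  ultimately show ?thesis
    using RX unfolding tame_end_def by (intro conjI ballI allI impI) assumption+
qed

text \<open>
  The parametrisation of a ray or an anti-ray by \<open>[0, \<infinity>)\<close> in which going to its end means going to
  infinity.
\<close>

fun tail_point :: "'a end_ray \<Rightarrow> real \<Rightarrow> 'a" where
  "tail_point (Ray R) u = R u"
| "tail_point (Anti_Ray R) u = R (- u)"

lemma ray_points_tail: "ray_points S = tail_point S ` {0..}"
proof (cases S)
  case (Anti_Ray R)
  have "{..0::real} = uminus ` {0..}" by simp
  then show ?thesis using Anti_Ray by (simp only: ray_points.simps image_image) simp
qed simp

lemma tame_tail:
  assumes X: "semimetric_on X d" and "cond_B1 X d" "cond_B2 X d"
    and "S \<in> qg_rays X d \<union> qg_anti_rays X d"
  shows "tame_end X d (tail_point S)"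
proof (cases S)
  case (Ray R)
  then have "Ray R \<in> qg_rays X d" using assms by (auto simp: qg_anti_rays_def)
  then have "tame_end X d R" using assms by (intro tame_ray)
  moreover have "tail_point S = R" using Ray by auto
  ultimately show ?thesis by simp
next
  case (Anti_Ray R)
  then have "Anti_Ray R \<in> qg_anti_rays X d" using assms by (auto simp: qg_rays_def)
  then have "Ray (\<lambda>s. R (- s)) \<in> qg_rays X (dual_dist d)"
    unfolding anti_ray_dual[OF X] .
  then have "tame_end X (dual_dist d) (\<lambda>s. R (- s))"
    by (rule tame_ray[OF semimetric_on_dual[OF X] cond_B2_dual[OF assms(2)]])
  moreover have "tail_point S = (\<lambda>s. R (- s))" using Anti_Ray by auto
  ultimately show ?thesis using tame_end_dual[of X d "tail_point S"] by simp
qed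

section \<open>The order on rays and anti-rays\<close>

definition tail_le :: "('a \<Rightarrow> 'a \<Rightarrow> ennreal) \<Rightarrow> (real \<Rightarrow> 'a) \<Rightarrow> (real \<Rightarrow> 'a) \<Rightarrow> bool" where
  "tail_le d \<rho> \<sigma> \<longleftrightarrow> (\<exists>M\<ge>0. \<forall>T\<ge>0. \<exists>u\<ge>T. \<exists>v\<ge>T. d (\<rho> u) (\<sigma> v) \<le> ennreal M)"

text \<open>
  Being far out along a tame end and being far from a given point are the same. If a path of length
  at most \<open>M\<close> starts late on \<open>R\<close>, it also ends late on \<open>S\<close>: otherwise its end point lies in a bounded
  initial segment, which brings its starting point into a fixed in-ball. Conversely, a geodesic of
  length at most \<open>M\<close> that meets a ball has its starting point in the in-ball or its end point in
  the out-ball with the radius increased by \<open>M\<close>, which late points avoid.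
\<close>

lemma ray_le_iff_tail_le:
  assumes X: "semimetric_on X d" and geo: "geodesic_space X d"
    and tame: "tame_end X d (tail_point R)" "tame_end X d (tail_point S)"
  shows "ray_le X d R S \<longleftrightarrow> tail_le d (tail_point R) (tail_point S)"
proof
  let ?\<rho> = "tail_point R" and ?\<sigma> = "tail_point S"
  have in_X: "?\<rho> u \<in> X" "?\<sigma> u \<in> X" if "0 \<le> u" for u
    using tame[THEN tame_end_in] that by blast+
  assume "ray_le X d R S"
  then obtain M where M: "0 \<le> M" and path: "\<And>r x. 0 \<le> r \<Longrightarrow> x \<in> X \<Longrightarrow> \<exists>p. directed_path X d p \<and>
        start_point p \<in> ray_points R \<and> end_point p \<in> ray_points S \<and> path_length d p \<le> ennreal M \<and>
        path_points p \<inter> (out_ball X d r x \<union> in_ball X d r x) = {}"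
    unfolding ray_le_def by blast
  show "tail_le d ?\<rho> ?\<sigma>"
    unfolding tail_le_def
  proof (rule exI[of _ M], intro conjI allI impI)
    fix T :: real assume T: "0 \<le> T"
    obtain z l where z: "z \<in> X" "0 \<le> l" "\<And>v. 0 \<le> v \<Longrightarrow> v \<le> T \<Longrightarrow> d (?\<sigma> v) z \<le> ennreal l"
      by (rule tame_end_bounded_to[OF tame(2) T]) blast
    obtain T' where T': "\<And>u. T' \<le> u \<Longrightarrow> \<not> d (?\<rho> u) z \<le> ennreal (M + l)"
      by (rule tame_end_far_to[OF tame(1) z(1)]) blast
    obtain x k where x: "x \<in> X" "0 \<le> k" "\<And>u. 0 \<le> u \<Longrightarrow> u \<le> max T T' \<Longrightarrow> d x (?\<rho> u) \<le> ennreal k"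
      by (rule tame_end_bounded_from[OF tame(1), of "max T T'"]) (use T in auto)
    obtain a b P where P: "a < b" "bicontinuous {a..b} X d P" "P a \<in> ray_points R" "P b \<in> ray_points S"
      "path_length d (a, b, P) \<le> ennreal M" "P ` {a..b} \<inter> (out_ball X d k x \<union> in_ball X d k x) = {}"
      using path[OF x(2,1)] by (auto simp del: path_length.simps)
    obtain u v where uv: "0 \<le> u" "P a = ?\<rho> u" "0 \<le> v" "P b = ?\<sigma> v"
      using P(3,4) unfolding ray_points_tail by auto
    have "d (P a) (P b) \<le> ennreal M"
      using dist_le_path_length[OF X P(2,1)] P(5) by (rule order_trans)
    then have d: "d (?\<rho> u) (?\<sigma> v) \<le> ennreal M" by (simp add: uv)
    have "P a \<in> P ` {a..b}" using P(1) by simp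
    then have "P a \<notin> out_ball X d k x" using P(6) by blast
    then have "\<not> d x (?\<rho> u) \<le> ennreal k" using uv in_X by (simp add: out_ball_def)
    then have u: "max T T' < u" using x(3)[OF uv(1)] by (meson not_le)
    then have "T \<le> u" by simp
    moreover have "T < v"
    proof (rule ccontr)
      assume "\<not> T < v"
      then have "d (?\<rho> u) z \<le> ennreal (M + l)"
        using z M uv in_X by (intro triangle_bound[OF X _ _ _ d]) auto
      then show False using T'[of u] u by auto
    qed
    ultimately show "\<exists>u\<ge>T. \<exists>v\<ge>T. d (?\<rho> u) (?\<sigma> v) \<le> ennreal M"
      using d by (meson less_imp_le)
  qed (rule M)
next
  let ?\<rho> = "tail_point R" and ?\<sigma> = "tail_point S"
  have in_X: "?\<rho> u \<in> X" "?\<sigma> u \<in> X" if "0 \<le> u" for u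
    using tame[THEN tame_end_in] that by blast+
  assume "tail_le d ?\<rho> ?\<sigma>"
  then obtain M where M: "0 \<le> M" "\<And>T. 0 \<le> T \<Longrightarrow> \<exists>u\<ge>T. \<exists>v\<ge>T. d (?\<rho> u) (?\<sigma> v) \<le> ennreal M"
    unfolding tail_le_def by blast
  show "ray_le X d R S"
    unfolding ray_le_def
  proof (intro exI[of _ M] conjI allI impI ballI)
    fix r :: real and x assume r: "0 \<le> r" and x: "x \<in> X"
    obtain T1 where T1: "\<And>u. T1 \<le> u \<Longrightarrow> \<not> d (?\<rho> u) x \<le> ennreal (M + r)"
      by (rule tame_end_far_to[OF tame(1) x]) blast
    obtain T2 where T2: "\<And>u. T2 \<le> u \<Longrightarrow> \<not> d x (?\<sigma> u) \<le> ennreal (r + M)"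
      by (rule tame_end_far_from[OF tame(2) x]) blast
    obtain u v where uv: "max 0 (max T1 T2) \<le> u" "max 0 (max T1 T2) \<le> v" "d (?\<rho> u) (?\<sigma> v) \<le> ennreal M"
      using M(2)[of "max 0 (max T1 T2)"] by auto
    have uvX: "?\<rho> u \<in> X" "?\<sigma> v \<in> X" using in_X uv by auto
    have "d (?\<rho> u) (?\<sigma> v) < \<infinity>" using uv(3) by (simp add: order_le_less_trans)
    then obtain p where p: "is_geodesic X d p" "start_point p = ?\<rho> u" "end_point p = ?\<sigma> v"
      using geo uvX unfolding geodesic_space_def by blast
    obtain a b P where abP: "p = (a, b, P)" using prod_cases3 by blast
    have P: "a < b" "bicontinuous {a..b} X d P" "path_length d (a, b, P) \<le> ennreal M"
      "P a = ?\<rho> u" "P b = ?\<sigma> v"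
      using p uv(3) by (auto simp: is_geodesic_def abP simp del: path_length.simps)
    have "P s \<notin> out_ball X d r x \<union> in_ball X d r x" if s: "s \<in> {a..b}" for s
    proof -
      have Ps: "P s \<in> X" by (rule bicontinuous_in[OF X P(2) s])
      have "d (P a) (P s) + d (P s) (P s) + d (P s) (P b) \<le> path_length d (a, b, P)"
        using s by (intro three_dists_le_path_length[OF X P(2,1)]) auto
      then have "d (P a) (P s) + d (P s) (P b) \<le> ennreal M"
        using P(3) semimetric_zero[OF X Ps] by (simp del: path_length.simps)
      then have le: "d (?\<rho> u) (P s) \<le> ennreal M" "d (P s) (?\<sigma> v) \<le> ennreal M"
        unfolding P(4,5) by (meson add_increasing add_increasing2 order_trans zero_le order_refl le_iff_add)+
      have "\<not> d (P s) x \<le> ennreal r"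
      proof
        assume "d (P s) x \<le> ennreal r"
        then have "d (?\<rho> u) x \<le> ennreal (M + r)"
          using uvX x Ps M(1) r by (intro triangle_bound[OF X _ _ _ le(1)]) auto
        then show False using T1[of u] uv by auto
      qed
      moreover have "\<not> d x (P s) \<le> ennreal r"
      proof
        assume "d x (P s) \<le> ennreal r"
        then have "d x (?\<sigma> v) \<le> ennreal (r + M)"
          using uvX x Ps M(1) r le by (intro triangle_bound[OF X, of _ _ "P s"]) auto
        then show False using T2[of v] uv by auto
      qed
      ultimately show ?thesis by (auto simp: in_ball_def out_ball_def)
    qed
    then show "\<exists>p. directed_path X d p \<and> start_point p \<in> ray_points R \<and> end_point p \<in> ray_points S \<and>
        path_length d p \<le> ennreal M \<and> path_points p \<inter> (out_ball X d r x \<union> in_ball X d r x) = {}"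
      using P uv unfolding ray_points_tail
      by (intro exI[of _ "(a, b, P)"]) (auto simp del: path_length.simps)
  qed (rule M)
qed

text \<open>
  From points \<open>\<rho>1 u\<close> and \<open>\<rho>2 v\<close> at distance at most \<open>M\<close> one gets points of \<open>\<sigma>1\<close> and \<open>\<sigma>2\<close> whose
  distance is bounded in terms of \<open>M\<close>. They are late: if the point of \<open>\<sigma>1\<close> were in the initial
  segment up to \<open>T\<close>, that is in a fixed out-ball, then \<open>\<rho>1 u\<close> would be in a fixed out-ball as
  well, which is excluded by choosing \<open>u\<close> large; similarly for \<open>\<sigma>2\<close> with in-balls.
\<close>

lemma tail_le_transfer:
  assumes X: "semimetric_on X dX" and Y: "semimetric_on Y dY" and qi: "qi_pair X dX Y dY A f g"
    and tame: "tame_end X dX \<rho>1" "tame_end X dX \<rho>2" "tame_end Y dY \<sigma>1" "tame_end Y dY \<sigma>2"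
    and near: "\<And>u. 0 \<le> u \<Longrightarrow> \<exists>v\<ge>0. dY (\<sigma>1 v) (f (\<rho>1 u)) \<le> ennreal K"
      "\<And>u. 0 \<le> u \<Longrightarrow> \<exists>v\<ge>0. dY (f (\<rho>2 u)) (\<sigma>2 v) \<le> ennreal K'"
    and K: "0 \<le> K" "0 \<le> K'"
    and le: "tail_le dX \<rho>1 \<rho>2"
  shows "tail_le dY \<sigma>1 \<sigma>2"
proof -
  note qi' = qi_pair_sym[OF qi]
  have A: "1 \<le> A" using qi by (simp add: qi_pair_def)
  have in_X: "\<rho>1 u \<in> X" "\<rho>2 u \<in> X" and in_Y: "\<sigma>1 u \<in> Y" "\<sigma>2 u \<in> Y" if "0 \<le> u" for u
    using tame[THEN tame_end_in] that by blast+
  obtain M where M: "0 \<le> M" "\<And>T. 0 \<le> T \<Longrightarrow> \<exists>u\<ge>T. \<exists>v\<ge>T. dX (\<rho>1 u) (\<rho>2 v) \<le> ennreal M"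
    using le unfolding tail_le_def by blast
  show ?thesis
    unfolding tail_le_def
  proof (rule exI[of _ "K + ((A * M + A) + K')"], intro conjI allI impI)
    show "0 \<le> K + ((A * M + A) + K')" using A M K by simp
    fix T :: real assume T: "0 \<le> T"
    obtain y1 k1 where y1: "y1 \<in> Y" "0 \<le> k1" "\<And>u. 0 \<le> u \<Longrightarrow> u \<le> T \<Longrightarrow> dY y1 (\<sigma>1 u) \<le> ennreal k1"
      by (rule tame_end_bounded_from[OF tame(3) T]) blast
    obtain y2 k2 where y2: "y2 \<in> Y" "0 \<le> k2" "\<And>u. 0 \<le> u \<Longrightarrow> u \<le> T \<Longrightarrow> dY (\<sigma>2 u) y2 \<le> ennreal k2"
      by (rule tame_end_bounded_to[OF tame(4) T]) blast
    have g1: "g y1 \<in> X" "f (g y1) \<in> Y" "dY (f (g y1)) y1 \<le> ennreal A"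
      and g2: "g y2 \<in> X" "f (g y2) \<in> Y" "dY y2 (f (g y2)) \<le> ennreal A"
      using y1(1) y2(1) qi qi_pair_in[OF qi] qi_pair_in[OF qi'] unfolding qi_pair_def by blast+
    (* The radii bound the distances in X when those in Y are bounded along the chains
       f (g y1), y1, \<sigma>1 u', f (\<rho>1 u) and f (\<rho>2 v), \<sigma>2 v', y2, f (g y2). *)
    obtain T1 where T1: "\<And>u. T1 \<le> u \<Longrightarrow> \<not> dX (g y1) (\<rho>1 u) \<le> ennreal (A * (A + (k1 + K)) + 3 * A)"
      by (rule tame_end_far_from[OF tame(1) g1(1)]) blast
    obtain T2 where T2: "\<And>u. T2 \<le> u \<Longrightarrow> \<not> dX (\<rho>2 u) (g y2) \<le> ennreal (A * (K' + (k2 + A)) + 3 * A)"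
      by (rule tame_end_far_to[OF tame(2) g2(1)]) blast
    obtain u v where uv: "max 0 (max T1 T2) \<le> u" "max 0 (max T1 T2) \<le> v" "dX (\<rho>1 u) (\<rho>2 v) \<le> ennreal M"
      using M(2)[of "max 0 (max T1 T2)"] by auto
    have uv0: "0 \<le> u" "0 \<le> v" using uv by auto
    obtain u' where u': "0 \<le> u'" "dY (\<sigma>1 u') (f (\<rho>1 u)) \<le> ennreal K" using near(1)[OF uv0(1)] by blast
    obtain v' where v': "0 \<le> v'" "dY (f (\<rho>2 v)) (\<sigma>2 v') \<le> ennreal K'" using near(2)[OF uv0(2)] by blast
    note in_fY = qi_pair_in[OF qi in_X(1)[OF uv0(1)]] qi_pair_in[OF qi in_X(2)[OF uv0(2)]]
    have "T < u'"
    proof (rule ccontr)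
      assume "\<not> T < u'"
      then have "dY y1 (\<sigma>1 u') \<le> ennreal k1" using y1(3) u' by simp
      then have "dY (f (g y1)) (f (\<rho>1 u)) \<le> ennreal (A + (k1 + K))"
        using y1 g1 u' in_fY in_Y K A
        by (intro triangle_bound[OF Y _ _ _ g1(3) triangle_bound[OF Y _ _ _ _ u'(2)]]) auto
      then have "dX (g y1) (\<rho>1 u) \<le> ennreal (A * (A + (k1 + K)) + 3 * A)"
        using g1 in_X uv0 A y1(2) K by (intro qi_pair_lower[OF qi X]) auto
      then show False using T1[of u] uv by auto
    qed
    moreover have "T < v'"
    proof (rule ccontr)
      assume "\<not> T < v'"
      then have "dY (\<sigma>2 v') y2 \<le> ennreal k2" using y2(3) v' by simp
      then have "dY (f (\<rho>2 v)) (f (g y2)) \<le> ennreal (K' + (k2 + A))"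
        using y2 g2 v' in_fY in_Y K A
        by (intro triangle_bound[OF Y _ _ _ v'(2) triangle_bound[OF Y _ _ _ _ g2(3)]]) auto
      then have "dX (\<rho>2 v) (g y2) \<le> ennreal (A * (K' + (k2 + A)) + 3 * A)"
        using g2 in_X uv0 A y2(2) K by (intro qi_pair_lower[OF qi X]) auto
      then show False using T2[of v] uv by auto
    qed
    moreover have "dY (\<sigma>1 u') (\<sigma>2 v') \<le> ennreal (K + ((A * M + A) + K'))"
    proof -
      have "dY (f (\<rho>1 u)) (f (\<rho>2 v)) \<le> ennreal (A * M + A)"
        using uv0 in_X M(1) uv(3) by (intro qi_pair_upper[OF qi]) auto
      then show ?thesis
        using u' v' in_fY in_Y K A M(1)
        by (intro triangle_bound[OF Y _ _ _ u'(2) triangle_bound[OF Y _ _ _ _ v'(2)]]) auto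
    qed
    ultimately show "\<exists>u\<ge>T. \<exists>v\<ge>T. dY (\<sigma>1 u) (\<sigma>2 v) \<le> ennreal (K + ((A * M + A) + K'))"
      by (meson less_imp_le)
  qed
qed

lemma ray_le_transfer:
  assumes X: "semimetric_on X dX" "geodesic_space X dX" and Y: "semimetric_on Y dY" "geodesic_space Y dY"
    and qi: "qi_pair X dX Y dY A f g"
    and tame: "tame_end X dX (tail_point R)" "tame_end X dX (tail_point R')"
      "tame_end Y dY (tail_point Q)" "tame_end Y dY (tail_point Q')"
    and foll: "follows Y dY Q (f ` ray_points R)" "follows Y dY Q' (f ` ray_points R')"
    and le: "ray_le X dX R R'"
  shows "ray_le Y dY Q Q'"
proof -
  have sub: "ray_points R \<subseteq> X" "ray_points R' \<subseteq> X" "ray_points Q \<subseteq> Y" "ray_points Q' \<subseteq> Y"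
    using tame[THEN tame_end_in] unfolding ray_points_tail by auto
  then have fsub: "f ` ray_points R \<subseteq> Y" "f ` ray_points R' \<subseteq> Y"
    using qi_pair_in[OF qi] by auto
  obtain K where K: "0 \<le> K" "\<And>z. z \<in> f ` ray_points R \<Longrightarrow> \<exists>q\<in>ray_points Q. dY q z \<le> ennreal K"
    using foll(1) unfolding follows_iff[OF fsub(1) sub(3)] by blast
  obtain K' where K': "0 \<le> K'" "\<And>z. z \<in> f ` ray_points R' \<Longrightarrow> \<exists>q\<in>ray_points Q'. dY z q \<le> ennreal K'"
    using foll(2) unfolding follows_iff[OF fsub(2) sub(4)] by blast
  have "tail_le dY (tail_point Q) (tail_point Q')"
  proof (rule tail_le_transfer[OF X(1) Y(1) qi tame _ _ K(1) K'(1)])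
    show "tail_le dX (tail_point R) (tail_point R')"
      using le ray_le_iff_tail_le[OF X tame(1,2)] by simp
    show "\<exists>v\<ge>0. dY (tail_point Q v) (f (tail_point R u)) \<le> ennreal K" if "0 \<le> u" for u
      using K(2)[of "f (tail_point R u)"] that unfolding ray_points_tail by auto
    show "\<exists>v\<ge>0. dY (f (tail_point R' u)) (tail_point Q' v) \<le> ennreal K'" if "0 \<le> u" for u
      using K'(2)[of "f (tail_point R' u)"] that unfolding ray_points_tail by auto
  qed
  then show ?thesis using ray_le_iff_tail_le[OF Y tame(3,4)] by simp
qed

lemma ray_le_refl:
  assumes X: "semimetric_on X d" "geodesic_space X d" and tame: "tame_end X d (tail_point R)"
  shows "ray_le X d R R"
  unfolding ray_le_iff_tail_le[OF X tame tame] tail_le_def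
proof (rule exI[of _ 0], intro conjI allI impI)
  fix T :: real assume "0 \<le> T"
  then have "d (tail_point R T) (tail_point R T) = 0"
    using tame_end_in[OF tame] by (intro semimetric_zero[OF X(1)]) auto
  then show "\<exists>u\<ge>T. \<exists>v\<ge>T. d (tail_point R u) (tail_point R v) \<le> ennreal 0"
    by (intro exI[of _ T]) auto
qed simp

section \<open>Followers of rays and anti-rays\<close>

lemma follows_dual:
  assumes "follows X (dual_dist d) Q Z"
  shows "follows X d Q Z"
proof -
  have "out_nbhd X (dual_dist d) = in_nbhd X d" "in_nbhd X (dual_dist d) = out_nbhd X d"
    by (simp_all add: fun_eq_iff out_nbhd_def in_nbhd_def out_ball_def in_ball_def)
  then show ?thesis using assms unfolding follows_def by (simp add: Int_commute)
qed

lemma follower_ray: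
  assumes X: "semimetric_on X dX" and Y: "semimetric_on Y dY" "geodesic_space Y dY"
    and qi: "qi_pair X dX Y dY A f g" and "R \<in> qg_rays X dX"
  shows "\<exists>Q\<in>qg_rays Y dY. same_kind R Q \<and> follows Y dY Q (f ` ray_points R)"
proof -
  obtain P where P: "R = Ray P" using assms(5) by (auto simp: qg_rays_def)
  then obtain \<gamma> c where "qg_ray_with X dX \<gamma> c P" using assms(5) qg_rays_iff by blast
  then obtain Q \<gamma>' c' where "qg_ray_with Y dY \<gamma>' c' Q" "follows Y dY (Ray Q) (f ` P ` {0..})"
    using ray_follower[OF X Y qi] by blast
  moreover from this have "Ray Q \<in> qg_rays Y dY" using qg_rays_iff by blast
  ultimately show ?thesis using P by (intro bexI[of _ "Ray Q"]) auto
qed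

lemma follower_anti_ray:
  assumes X: "semimetric_on X dX" and Y: "semimetric_on Y dY" "geodesic_space Y dY"
    and qi: "qi_pair X dX Y dY A f g" and "R \<in> qg_anti_rays X dX"
  shows "\<exists>Q\<in>qg_anti_rays Y dY. same_kind R Q \<and> follows Y dY Q (f ` ray_points R)"
proof -
  note X' = semimetric_on_dual[OF X] and Y' = semimetric_on_dual[OF Y(1)]
  obtain P where P: "R = Anti_Ray P" using assms(5) by (auto simp: qg_anti_rays_def)
  then have "Ray (\<lambda>s. P (- s)) \<in> qg_rays X (dual_dist dX)"
    using assms(5) anti_ray_dual[OF X] by blast
  then obtain S where S: "S \<in> qg_rays Y (dual_dist dY)" "same_kind (Ray (\<lambda>s. P (- s))) S"
    "follows Y (dual_dist dY) S (f ` ray_points (Ray (\<lambda>s. P (- s))))"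
    using follower_ray[OF X' Y' geodesic_space_dual[OF Y] qi_pair_dual[OF qi]] by blast
  then obtain Q where Q: "S = Ray Q" by (cases S) auto
  let ?Q = "Anti_Ray (\<lambda>s. Q (- s))"
  have "?Q \<in> qg_anti_rays Y dY"
    unfolding anti_ray_dual[OF Y(1)] using S Q by simp
  moreover have "ray_points ?Q = ray_points S" "ray_points R = ray_points (Ray (\<lambda>s. P (- s)))"
    unfolding ray_points_tail P Q by simp_all
  then have "follows Y dY ?Q (f ` ray_points R)"
    using follows_dual[OF S(3)] by (simp add: follows_def)
  ultimately show ?thesis using P by (intro bexI[of _ ?Q]) auto
qed

section \<open>The maps between the boundaries\<close>

text \<open>
  Following the image relates \<open>E1\<close> to \<open>E2\<close> so that every element of either set has a partner, and
  partners have the same order relations. A class is therefore determined by the partners of its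
  elements: two elements of \<open>E1\<close> have equal classes, compared as sets, if and only if their partners
  have. This single equivalence makes the map on classes both well defined and injective.
\<close>

lemma class_bijection:
  assumes refl: "\<And>R. R \<in> E1 \<Longrightarrow> ray_le X1 d1 R R" "\<And>Q. Q \<in> E2 \<Longrightarrow> ray_le X2 d2 Q Q"
    and total: "\<And>R. R \<in> E1 \<Longrightarrow> \<exists>Q\<in>E2. same_kind R Q \<and> follows X2 d2 Q (f ` ray_points R)"
    and onto: "\<And>Q. Q \<in> E2 \<Longrightarrow> \<exists>R\<in>E1. same_kind R Q \<and> follows X2 d2 Q (f ` ray_points R)"
    and le_iff: "\<And>R R' Q Q'. R \<in> E1 \<Longrightarrow> R' \<in> E1 \<Longrightarrow> Q \<in> E2 \<Longrightarrow> Q' \<in> E2 \<Longrightarrow>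
      follows X2 d2 Q (f ` ray_points R) \<Longrightarrow> follows X2 d2 Q' (f ` ray_points R') \<Longrightarrow>
      ray_le X1 d1 R R' \<longleftrightarrow> ray_le X2 d2 Q Q'"
  shows "\<exists>\<phi>. canonically_defines X1 d1 E1 X2 d2 E2 f \<phi> \<and>
    bij_betw \<phi> (classes X1 d1 E1) (classes X2 d2 E2) \<and>
    monotone_on (classes X1 d1 E1) (class_le X1 d1) (class_le X2 d2) \<phi>"
proof -
  define F where "F = (\<lambda>R Q. R \<in> E1 \<and> Q \<in> E2 \<and> same_kind R Q \<and> follows X2 d2 Q (f ` ray_points R))"
  let ?c1 = "\<lambda>R. ray_equiv X1 d1 E1 `` {R}" and ?c2 = "\<lambda>Q. ray_equiv X2 d2 E2 `` {Q}"
  have equiv_iff: "R' \<in> ?c1 R \<longleftrightarrow> Q' \<in> ?c2 Q" if "F R Q" "F R' Q'" for R Q R' Q'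
    using that le_iff[of R R' Q Q'] le_iff[of R' R Q' Q] by (auto simp: ray_equiv_def F_def)
  have class_eq_iff: "?c1 R = ?c1 R' \<longleftrightarrow> ?c2 Q = ?c2 Q'" if F: "F R Q" "F R' Q'" for R Q R' Q'
  proof
    assume eq: "?c1 R = ?c1 R'"
    have "S \<in> ?c2 Q \<longleftrightarrow> S \<in> ?c2 Q'" for S
    proof (cases "S \<in> E2")
      case True
      then obtain T where "F T S" using onto by (auto simp: F_def)
      then show ?thesis using equiv_iff[OF F(1), of T S] equiv_iff[OF F(2), of T S] eq by blast
    qed (auto simp: ray_equiv_def)
    then show "?c2 Q = ?c2 Q'" by blast
  next
    assume eq: "?c2 Q = ?c2 Q'"
    have "S \<in> ?c1 R \<longleftrightarrow> S \<in> ?c1 R'" for S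
    proof (cases "S \<in> E1")
      case True
      then obtain T where "F S T" using total by (auto simp: F_def)
      then show ?thesis using equiv_iff[OF F(1), of S T] equiv_iff[OF F(2), of S T] eq by blast
    qed (auto simp: ray_equiv_def)
    then show "?c1 R = ?c1 R'" by blast
  qed
  (* The image of a class is the class of an arbitrary partner of an arbitrary generator. *)
  define \<phi> where "\<phi> = (\<lambda>C. ?c2 (SOME Q. \<exists>R. F R Q \<and> C = ?c1 R))"
  have \<phi>: "\<phi> (?c1 R) = ?c2 Q" if "F R Q" for R Q
  proof -
    define Q' where "Q' = (SOME Q. \<exists>R'. F R' Q \<and> ?c1 R = ?c1 R')"
    have "\<exists>R'. F R' Q' \<and> ?c1 R = ?c1 R'"
      unfolding Q'_def by (rule someI[of _ Q]) (use that in blast)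
    then obtain R' where "F R' Q'" "?c1 R = ?c1 R'" by blast
    then have "?c2 Q = ?c2 Q'" using class_eq_iff[OF that] by blast
    then show ?thesis by (simp add: \<phi>_def Q'_def)
  qed
  have classes: "classes X1 d1 E1 = ?c1 ` E1" "classes X2 d2 E2 = ?c2 ` E2"
    by (auto simp: classes_def quotient_def)
  have "canonically_defines X1 d1 E1 X2 d2 E2 f \<phi>"
    unfolding canonically_defines_def
  proof (intro ballI conjI impI)
    fix R assume R: "R \<in> E1"
    show "\<exists>Q\<in>E2. same_kind R Q \<and> follows X2 d2 Q (f ` ray_points R)" by (rule total[OF R])
    fix Q assume "Q \<in> E2" "same_kind R Q \<and> follows X2 d2 Q (f ` ray_points R)"
    then show "\<phi> (?c1 R) = ?c2 Q" using R by (intro \<phi>) (simp add: F_def)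
  qed
  moreover have "bij_betw \<phi> (classes X1 d1 E1) (classes X2 d2 E2)"
    unfolding bij_betw_def classes
  proof
    show "inj_on \<phi> (?c1 ` E1)"
    proof (rule inj_onI)
      fix C D assume "C \<in> ?c1 ` E1" "D \<in> ?c1 ` E1" and eq: "\<phi> C = \<phi> D"
      then obtain R R' where R: "R \<in> E1" "C = ?c1 R" "R' \<in> E1" "D = ?c1 R'" by blast
      obtain Q where Q: "F R Q" using total[OF R(1)] R(1) unfolding F_def by blast
      obtain Q' where Q': "F R' Q'" using total[OF R(3)] R(3) unfolding F_def by blast
      have "?c2 Q = ?c2 Q'" using eq \<phi>[OF Q] \<phi>[OF Q'] R by simp
      then show "C = D" using class_eq_iff[OF Q Q'] R by simp
    qed
    show "\<phi> ` ?c1 ` E1 = ?c2 ` E2"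
    proof (intro equalityI subsetI)
      fix D assume "D \<in> \<phi> ` ?c1 ` E1"
      then obtain R where R: "R \<in> E1" "D = \<phi> (?c1 R)" by blast
      obtain Q where Q: "F R Q" using total[OF R(1)] R(1) unfolding F_def by blast
      then show "D \<in> ?c2 ` E2" using \<phi>[OF Q] R by (auto simp: F_def)
    next
      fix D assume "D \<in> ?c2 ` E2"
      then obtain Q where Q: "Q \<in> E2" "D = ?c2 Q" by blast
      obtain R where R: "F R Q" using onto[OF Q(1)] Q(1) unfolding F_def by blast
      have "R \<in> E1" using R by (simp add: F_def)
      then show "D \<in> \<phi> ` ?c1 ` E1" using \<phi>[OF R] Q by (metis imageI)
    qed
  qed
  moreover have "monotone_on (classes X1 d1 E1) (class_le X1 d1) (class_le X2 d2) \<phi>"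
    unfolding classes
  proof (rule monotone_onI)
    fix C D assume "C \<in> ?c1 ` E1" "D \<in> ?c1 ` E1" "class_le X1 d1 C D"
    then obtain R S R' S' where R: "C = ?c1 R" "D = ?c1 S" "R \<in> E1" "S \<in> E1"
      "R' \<in> ?c1 R" "S' \<in> ?c1 S" "ray_le X1 d1 R' S'"
      unfolding class_le_def by blast
    have E: "R' \<in> E1" "S' \<in> E1" using R(5,6) by (auto simp: ray_equiv_def)
    obtain Q where Q: "F R Q" using total[OF R(3)] R(3) unfolding F_def by blast
    obtain P where P: "F S P" using total[OF R(4)] R(4) unfolding F_def by blast
    obtain Q' where Q': "F R' Q'" using total[OF E(1)] E(1) unfolding F_def by blast
    obtain P' where P': "F S' P'" using total[OF E(2)] E(2) unfolding F_def by blast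
    have "Q' \<in> \<phi> C" "P' \<in> \<phi> D"
      using equiv_iff[OF Q Q'] equiv_iff[OF P P'] R \<phi>[OF Q] \<phi>[OF P] by simp_all
    moreover have "ray_le X2 d2 Q' P'"
      using R(7) le_iff[of R' S' Q' P'] Q' P' unfolding F_def by blast
    ultimately show "class_le X2 d2 (\<phi> C) (\<phi> D)"
      unfolding class_le_def by blast
  qed
  ultimately show ?thesis by blast
qed

lemma same_kind_sym: "same_kind R Q \<Longrightarrow> same_kind Q R"
  by (cases R; cases Q) auto

theorem theorem5p4:
  fixes X1 :: "'a set" and d1 :: "'a \<Rightarrow> 'a \<Rightarrow> ennreal"
    and X2 :: "'b set" and d2 :: "'b \<Rightarrow> 'b \<Rightarrow> ennreal"
    and f :: "'a \<Rightarrow> 'b"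
  assumes "semimetric_on X1 d1" and "geodesic_space X1 d1" and "hyperbolic_space X1 d1"
    and "cond_B1 X1 d1" and "cond_B2 X1 d1"
    and "semimetric_on X2 d2" and "geodesic_space X2 d2" and "hyperbolic_space X2 d2"
    and "cond_B1 X2 d2" and "cond_B2 X2 d2"
    and "quasi_isometry X1 d1 X2 d2 f"
  shows
    "(\<exists>\<phi>. canonically_defines X1 d1 (qg_rays X1 d1) X2 d2 (qg_rays X2 d2) f \<phi> \<and>
          bij_betw \<phi> (f_boundary X1 d1) (f_boundary X2 d2) \<and>
          monotone_on (f_boundary X1 d1) (class_le X1 d1) (class_le X2 d2) \<phi>) \<and>
     (\<exists>\<phi>. canonically_defines X1 d1 (qg_anti_rays X1 d1) X2 d2 (qg_anti_rays X2 d2) f \<phi> \<and>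
          bij_betw \<phi> (b_boundary X1 d1) (b_boundary X2 d2) \<and>
          monotone_on (b_boundary X1 d1) (class_le X1 d1) (class_le X2 d2) \<phi>) \<and>
     (\<exists>\<phi>. canonically_defines X1 d1 (qg_rays X1 d1 \<union> qg_anti_rays X1 d1)
            X2 d2 (qg_rays X2 d2 \<union> qg_anti_rays X2 d2) f \<phi> \<and>
          bij_betw \<phi> (qg_boundary X1 d1) (qg_boundary X2 d2) \<and>
          monotone_on (qg_boundary X1 d1) (class_le X1 d1) (class_le X2 d2) \<phi>)"
proof -
  note X1 = assms(1,2) and X2 = assms(6,7)
  obtain A g where qi: "qi_pair X1 d1 X2 d2 A f g"
    using quasi_isometry_qi_pair[OF assms(1,6,11)] .
  note qi' = qi_pair_sym[OF qi]
  let ?E1 = "qg_rays X1 d1 \<union> qg_anti_rays X1 d1" and ?E2 = "qg_rays X2 d2 \<union> qg_anti_rays X2 d2"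
  note tame1 = tame_tail[OF assms(1,4,5)] and tame2 = tame_tail[OF assms(6,9,10)]
  have points: "ray_points R \<subseteq> X1" "ray_points Q \<subseteq> X2" if "R \<in> ?E1" "Q \<in> ?E2" for R Q
    using tame1[OF that(1), THEN tame_end_in] tame2[OF that(2), THEN tame_end_in]
    unfolding ray_points_tail by auto
  have sym: "follows X1 d1 R (g ` ray_points Q) \<longleftrightarrow> follows X2 d2 Q (f ` ray_points R)"
    if "R \<in> ?E1" "Q \<in> ?E2" for R Q
    using follows_inverse[OF assms(1) qi points[OF that]]
      follows_inverse[OF assms(6) qi' points(2,1)[OF that]] by blast
  have main: "\<exists>\<phi>. canonically_defines X1 d1 E1 X2 d2 E2 f \<phi> \<and>
      bij_betw \<phi> (classes X1 d1 E1) (classes X2 d2 E2) \<and>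
      monotone_on (classes X1 d1 E1) (class_le X1 d1) (class_le X2 d2) \<phi>"
    if sub: "E1 \<subseteq> ?E1" "E2 \<subseteq> ?E2"
      and ex: "\<And>R. R \<in> E1 \<Longrightarrow> \<exists>Q\<in>E2. same_kind R Q \<and> follows X2 d2 Q (f ` ray_points R)"
        "\<And>Q. Q \<in> E2 \<Longrightarrow> \<exists>R\<in>E1. same_kind Q R \<and> follows X1 d1 R (g ` ray_points Q)"
    for E1 E2
  proof (rule class_bijection)
    show "ray_le X1 d1 R R" if "R \<in> E1" for R
      using that sub by (intro ray_le_refl[OF X1] tame1) auto
    show "ray_le X2 d2 Q Q" if "Q \<in> E2" for Q
      using that sub by (intro ray_le_refl[OF X2] tame2) auto
    show "\<exists>Q\<in>E2. same_kind R Q \<and> follows X2 d2 Q (f ` ray_points R)" if "R \<in> E1" for R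
      by (rule ex(1)[OF that])
    show "\<exists>R\<in>E1. same_kind R Q \<and> follows X2 d2 Q (f ` ray_points R)" if "Q \<in> E2" for Q
      using ex(2)[OF that] sym sub that same_kind_sym by blast
  next
    fix R R' Q Q' assume E: "R \<in> E1" "R' \<in> E1" "Q \<in> E2" "Q' \<in> E2"
      and foll: "follows X2 d2 Q (f ` ray_points R)" "follows X2 d2 Q' (f ` ray_points R')"
    have E': "R \<in> ?E1" "R' \<in> ?E1" "Q \<in> ?E2" "Q' \<in> ?E2" using E sub by auto
    note tame = tame1[OF E'(1)] tame1[OF E'(2)] tame2[OF E'(3)] tame2[OF E'(4)]
    have foll': "follows X1 d1 R (g ` ray_points Q)" "follows X1 d1 R' (g ` ray_points Q')"
      using foll sym E' by blast+
    show "ray_le X1 d1 R R' \<longleftrightarrow> ray_le X2 d2 Q Q'"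
      using ray_le_transfer[OF X1 X2 qi tame foll]
        ray_le_transfer[OF X2 X1 qi' tame(3,4,1,2) foll'] by blast
  qed
  note ray12 = follower_ray[OF assms(1) X2 qi] and anti12 = follower_anti_ray[OF assms(1) X2 qi]
  note ray21 = follower_ray[OF assms(6) X1 qi'] and anti21 = follower_anti_ray[OF assms(6) X1 qi']
  show ?thesis
    unfolding f_boundary_def b_boundary_def qg_boundary_def
  proof (intro conjI main)
    fix R assume "R \<in> ?E1"
    then show "\<exists>Q\<in>?E2. same_kind R Q \<and> follows X2 d2 Q (f ` ray_points R)"
      using ray12[of R] anti12[of R] by blast
  next
    fix Q assume "Q \<in> ?E2"
    then show "\<exists>R\<in>?E1. same_kind Q R \<and> follows X1 d1 R (g ` ray_points Q)"
      using ray21[of Q] anti21[of Q] by blast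
  qed (use ray12 anti12 ray21 anti21 in auto)
qed

end
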